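(* The triple $\Gamma=(\mathbf{Gr},\mathrm{Trees},\{K^n\}_{n\ge0})$ is a complete width category, and for every graph $G\in\mathbf{Gr}$ the $\Gamma$-width of $G$ is its treewidth: $\mathbf{w}_\Gamma(G)=\mathbf{tw}(G)$.
   Context: Graphs: a graph $G$ is a finite vertex set $V(G)$ with a symmetric irreflexive relation $E(G)\subseteq V(G)^2$; a graph homomorphism is a function on vertices sending edges to edges. $\mathbf{Gr}$ is the category of graphs and graph homomorphisms (finite sets are taken from a fixed small skeleton, so $\mathbf{Gr}$ is small). $K^n$ is the complete graph on $n$ vertices, $K^0=\varnothing$. A tree is a nonempty connected graph with no cycles; $\mathrm{Trees}$ is the set of all (finite) trees. For a graph $G$, the category $\int G$ has as objects the vertices and the (unordered) edges of $G$; its only non-identity morphisms are, for each edge $e=xy$, two morphisms $e_x:e\to x$ and $e_y:e\to y$. Structured decompositions: for a set $\mathcal{G}$ of graphs, a $\mathcal{G}$-structured decomposition in a category $\mathcal{C}$ is a functor $d:\int G\to\mathcal{C}$, $G\in\mathcal{G}$, sending every morphism to a monomorphism; the $d(v)$, $v\in V(G)$, are its bags. It is a decomposition of an object $X$ if $X\cong\operatorname{colim} d$. Spined sd-category: a triple $(\mathcal{C},\mathcal{G},\Omega)$ with $\mathcal{C}$ a small category, $\mathcal{G}$ a set of graphs containing the one-vertex graph, such that (W1) every $\mathcal{G}$-structured decomposition has a colimit in $\mathcal{C}$; and $\Omega=\bigcup_{n\ge0}\Omega_n$ a full subcategory closed under isomorphism, filtered by full subcategories $\Omega_0\subseteq\Omega_1\subseteq\cdots$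 closed under isomorphism, such that (W2a) every object admits a monomorphism into some object of $\Omega$; (W2b) for $n\ge1$ and $W\in\Omega_n\setminus\Omega_{n-1}$ there is no monomorphism from $W$ into an object of $\Omega_{n-1}$. The notation $\{K^n\}_{n\ge0}$ denotes the spine where $\Omega_n$ consists of the graphs isomorphic to $K^m$ for some $m\le n$. Width category: a spined sd-category in which pullbacks of monomorphisms along arbitrary morphisms exist and (W3) for every $\mathcal{G}$-structured decomposition $d$ of an object $Y$ and every monomorphism $f:X\to Y$, the pullback along $f$ of the colimit cocone $(d(i)\to Y)_i$ (objects $X\times_Y d(i)$, with projections to $X$) exists and is a colimit cocone with apex $X$. Complete: a completion of a $\mathcal{G}$-structured decomposition $d:\int G\to\mathcal{C}$ is a natural transformation $\alpha:d\Rightarrow d'$ to a diagram $d':\int G\to\mathcal{C}$ with every $d'(x)$ ($x$ a vertex) in $\Omega$, every component at an edge object an identity and every component at a vertex object a monomorphism. The width category is complete if (W4) for every such completion the induced map $\operatorname{colim} d\to\operatorname{colim} d'$ is a monomorphism. $\Gamma$-width: $s(X)$ is the smallest $n$ such that there is a monomorphism from $X$ into an object of $\Omega_n$; $w(d)=\max_{x\in V(G)}s(d(x))-1$ for $d:\int G\to\mathcal{C}$; $\mathbf{w}_\Gamma(X)=\min_d w(d)$ over all $\mathcal{G}$-structured decompositions $d$ of $X$. Treewidth: an RS-tree decomposition of a graph $G$ is a tree $T$ with a function $X:V(T)\to P(V(G))$ such that (1) $\bigcup_t X(t)=V(G)$; (2) every edge of $G$ has both ends in some $X(t)$; (3) if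 $t_2$ lies on the unique path between $t_1$ and $t_3$ in $T$ then $X(t_1)\cap X(t_3)\subseteq X(t_2)$. Its width is $\max_t|X(t)|-1$, and $\mathbf{tw}(G)$ is the minimum width over all RS-tree decompositions of $G$. *)

theory Defs
  imports "Graph_Theory.Digraph_Component" "HOL-Library.FuncSet"
begin

section \<open>Categories with explicit carriers\<close>

record ('o, 'm) cat =
  Obj :: "'o set"
  Arr :: "'m set"
  Dom :: "'m \<Rightarrow> 'o"
  Cod :: "'m \<Rightarrow> 'o"
  Ident :: "'o \<Rightarrow> 'm"
  Comp :: "'m \<Rightarrow> 'm \<Rightarrow> 'm" (infixl "\<cdot>\<index>" 70)

definition homset :: "('o, 'm) cat \<Rightarrow> 'o \<Rightarrow> 'o \<Rightarrow> 'm set" where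
  "homset C X Y = {f \<in> Arr C. Dom C f = X \<and> Cod C f = Y}"

locale small_category =
  fixes C :: "('o, 'm) cat" (structure)
  assumes Dom_in_Obj: "f \<in> Arr C \<Longrightarrow> Dom C f \<in> Obj C"
    and Cod_in_Obj: "f \<in> Arr C \<Longrightarrow> Cod C f \<in> Obj C"
    and Ident_in_homset: "X \<in> Obj C \<Longrightarrow> Ident C X \<in> homset C X X"
    and Comp_in_homset:
      "\<lbrakk>f \<in> homset C X Y; g \<in> homset C Y Z\<rbrakk> \<Longrightarrow> g \<cdot> f \<in> homset C X Z"
    and Comp_Ident: "f \<in> homset C X Y \<Longrightarrow> f \<cdot> Ident C X = f"
    and Ident_Comp: "f \<in> homset C X Y \<Longrightarrow> Ident C Y \<cdot> f = f"
    and Comp_assoc: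
      "\<lbrakk>f \<in> homset C W X; g \<in> homset C X Y; h \<in> homset C Y Z\<rbrakk>
        \<Longrightarrow> h \<cdot> (g \<cdot> f) = (h \<cdot> g) \<cdot> f"

definition monic :: "('o, 'm) cat \<Rightarrow> 'm \<Rightarrow> bool" where
  "monic C m \<longleftrightarrow> m \<in> Arr C \<and>
     (\<forall>Z. \<forall>f \<in> homset C Z (Dom C m). \<forall>g \<in> homset C Z (Dom C m).
        m \<cdot>\<^bsub>C\<^esub> f = m \<cdot>\<^bsub>C\<^esub> g \<longrightarrow> f = g)"

definition iso_objs :: "('o, 'm) cat \<Rightarrow> 'o \<Rightarrow> 'o \<Rightarrow> bool" where
  "iso_objs C X Y \<longleftrightarrow> X \<in> Obj C \<and> Y \<in> Obj C \<and>
     (\<exists>f \<in> homset C X Y. \<exists>g \<in> homset C Y X.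
        g \<cdot>\<^bsub>C\<^esub> f = Ident C X \<and> f \<cdot>\<^bsub>C\<^esub> g = Ident C Y)"

definition is_pullback :: "('o, 'm) cat \<Rightarrow> 'm \<Rightarrow> 'm \<Rightarrow> 'm \<Rightarrow> 'm \<Rightarrow> bool" where
  "is_pullback C f g p q \<longleftrightarrow>
     {f, g, p, q} \<subseteq> Arr C \<and> Cod C f = Cod C g \<and> Dom C p = Dom C q \<and>
     Cod C p = Dom C f \<and> Cod C q = Dom C g \<and> f \<cdot>\<^bsub>C\<^esub> p = g \<cdot>\<^bsub>C\<^esub> q \<and>
     (\<forall>Z. \<forall>p' \<in> homset C Z (Dom C f). \<forall>q' \<in> homset C Z (Dom C g).
        f \<cdot>\<^bsub>C\<^esub> p' = g \<cdot>\<^bsub>C\<^esub> q' \<longrightarrow>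
        (\<exists>!h. h \<in> homset C Z (Dom C p) \<and> p \<cdot>\<^bsub>C\<^esub> h = p' \<and> q \<cdot>\<^bsub>C\<^esub> h = q'))"

record ('i, 'u, 'o, 'm) diagram =
  obj_map :: "'i \<Rightarrow> 'o"
  arr_map :: "'u \<Rightarrow> 'm"

definition is_functor ::
  "('i, 'u) cat \<Rightarrow> ('o, 'm) cat \<Rightarrow> ('i, 'u, 'o, 'm) diagram \<Rightarrow> bool" where
  "is_functor J C d \<longleftrightarrow>
     (\<forall>i \<in> Obj J. obj_map d i \<in> Obj C) \<and>
     (\<forall>u \<in> Arr J. arr_map d u \<in> homset C (obj_map d (Dom J u)) (obj_map d (Cod J u))) \<and>
     (\<forall>i \<in> Obj J. arr_map d (Ident J i) = Ident C (obj_map d i)) \<and>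
     (\<forall>u \<in> Arr J. \<forall>v \<in> Arr J. Cod J u = Dom J v \<longrightarrow>
        arr_map d (v \<cdot>\<^bsub>J\<^esub> u) = arr_map d v \<cdot>\<^bsub>C\<^esub> arr_map d u)"

definition is_nat_trans ::
  "('i, 'u) cat \<Rightarrow> ('o, 'm) cat \<Rightarrow> ('i, 'u, 'o, 'm) diagram \<Rightarrow> ('i, 'u, 'o, 'm) diagram
     \<Rightarrow> ('i \<Rightarrow> 'm) \<Rightarrow> bool" where
  "is_nat_trans J C d d' \<alpha> \<longleftrightarrow>
     is_functor J C d \<and> is_functor J C d' \<and>
     (\<forall>i \<in> Obj J. \<alpha> i \<in> homset C (obj_map d i) (obj_map d' i)) \<and>
     (\<forall>u \<in> Arr J. \<alpha> (Cod J u) \<cdot>\<^bsub>C\<^esub> arr_map d u = arr_map d' u \<cdot>\<^bsub>C\<^esub> \<alpha> (Dom J u))"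

definition is_cocone ::
  "('i, 'u) cat \<Rightarrow> ('o, 'm) cat \<Rightarrow> ('i, 'u, 'o, 'm) diagram \<Rightarrow> 'o \<Rightarrow> ('i \<Rightarrow> 'm) \<Rightarrow> bool" where
  "is_cocone J C d X c \<longleftrightarrow>
     X \<in> Obj C \<and> (\<forall>i \<in> Obj J. c i \<in> homset C (obj_map d i) X) \<and>
     (\<forall>u \<in> Arr J. c (Cod J u) \<cdot>\<^bsub>C\<^esub> arr_map d u = c (Dom J u))"

definition is_colimit_cocone ::
  "('i, 'u) cat \<Rightarrow> ('o, 'm) cat \<Rightarrow> ('i, 'u, 'o, 'm) diagram \<Rightarrow> 'o \<Rightarrow> ('i \<Rightarrow> 'm) \<Rightarrow> bool" where
  "is_colimit_cocone J C d X c \<longleftrightarrow>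
     is_cocone J C d X c \<and>
     (\<forall>Y b. is_cocone J C d Y b \<longrightarrow>
        (\<exists>!h. h \<in> homset C X Y \<and> (\<forall>i \<in> Obj J. h \<cdot>\<^bsub>C\<^esub> c i = b i)))"

text \<open>
  \<open>is_pullback_cocone J C d c f d' p q\<close>: the cocone \<open>p\<close> under the diagram \<open>d'\<close>, whose apex is
  the domain of \<open>f\<close>, is obtained by pulling back the cocone \<open>c\<close> under \<open>d\<close> along \<open>f\<close>; \<open>q\<close> consists of
  the other projections. The last clause determines the action of \<open>d'\<close> on arrows.
\<close>
definition is_pullback_cocone ::
  "('i, 'u) cat \<Rightarrow> ('o, 'm) cat \<Rightarrow> ('i, 'u, 'o, 'm) diagram \<Rightarrow> ('i \<Rightarrow> 'm) \<Rightarrow> 'm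
     \<Rightarrow> ('i, 'u, 'o, 'm) diagram \<Rightarrow> ('i \<Rightarrow> 'm) \<Rightarrow> ('i \<Rightarrow> 'm) \<Rightarrow> bool" where
  "is_pullback_cocone J C d c f d' p q \<longleftrightarrow>
     is_functor J C d' \<and>
     (\<forall>i \<in> Obj J. is_pullback C f (c i) (p i) (q i) \<and> Dom C (p i) = obj_map d' i) \<and>
     (\<forall>u \<in> Arr J. p (Cod J u) \<cdot>\<^bsub>C\<^esub> arr_map d' u = p (Dom J u) \<and>
        q (Cod J u) \<cdot>\<^bsub>C\<^esub> arr_map d' u = arr_map d u \<cdot>\<^bsub>C\<^esub> q (Dom J u))"


section \<open>The category of graphs\<close>

type_synonym gr_arrow = "nat pair_pre_digraph \<times> (nat \<Rightarrow> nat) \<times> nat pair_pre_digraph"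

definition graph_hom :: "'a pair_pre_digraph \<Rightarrow> 'b pair_pre_digraph \<Rightarrow> ('a \<Rightarrow> 'b) set" where
  "graph_hom G H = {f \<in> pverts G \<rightarrow>\<^sub>E pverts H. \<forall>(x, y) \<in> parcs G. (f x, f y) \<in> parcs H}"

text \<open>
  The skeleton of finite sets is \<open>{..<n}\<close>, \<open>n :: nat\<close>. Homomorphisms are extensional on the vertex
  set, so that equality of arrows is equality of functions on vertices.
\<close>
definition Gr :: "(nat pair_pre_digraph, gr_arrow) cat" where
  "Gr = \<lparr>Obj = {G. pair_graph G \<and> (\<exists>n. pverts G = {..<n})},
         Arr = {(G, f, H). pair_graph G \<and> (\<exists>n. pverts G = {..<n}) \<and>
                  pair_graph H \<and> (\<exists>n. pverts H = {..<n}) \<and> f \<in> graph_hom G H},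
         Dom = (\<lambda>(G, f, H). G),
         Cod = (\<lambda>(G, f, H). H),
         Ident = (\<lambda>G. (G, restrict id (pverts G), G)),
         Comp = (\<lambda>(G', g, H') (G, f, H). (G, compose (pverts G) g f, H'))\<rparr>"

definition complete_gr :: "nat \<Rightarrow> nat pair_pre_digraph" where
  "complete_gr n = \<lparr>pverts = {..<n}, parcs = {(x, y). x < n \<and> y < n \<and> x \<noteq> y}\<rparr>"

definition clique_spine :: "nat \<Rightarrow> nat pair_pre_digraph set" where
  "clique_spine n = {G \<in> Obj Gr. \<exists>m \<le> n. iso_objs Gr G (complete_gr m)}"

text \<open>
  A cycle of the library may consist of an arc and its inverse, so that no graph with an edge is a
  library \<open>tree\<close>; the cycles of an undirected graph are those of length at least 3.
  \<open>Digraph_Component.connected\<close> includes nonemptiness.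
\<close>
definition is_tree :: "'a pair_pre_digraph \<Rightarrow> bool" where
  "is_tree T \<longleftrightarrow> pair_graph T \<and> Digraph_Component.connected (with_proj T) \<and>
     \<not> (\<exists>p. pre_digraph.cycle (with_proj T) p \<and> 3 \<le> length p)"

definition Trees :: "nat pair_pre_digraph set" where
  "Trees = {T \<in> Obj Gr. is_tree T}"

datatype 'a int_obj = VertObj 'a | EdgeObj "'a set"

text \<open>\<open>Leg e x\<close> is the arrow \<open>e \<rightarrow> x\<close> for an end \<open>x\<close> of the edge \<open>e\<close>.\<close>
datatype 'a int_arr = Idn "'a int_obj" | Leg "'a set" 'a

definition int_objs :: "'a pair_pre_digraph \<Rightarrow> 'a int_obj set" where
  "int_objs G = VertObj ` pverts G \<union> {EdgeObj {x, y} | x y. (x, y) \<in> parcs G}"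

definition int_cat :: "'a pair_pre_digraph \<Rightarrow> ('a int_obj, 'a int_arr) cat" where
  "int_cat G =
    \<lparr>Obj = int_objs G,
     Arr = Idn ` int_objs G \<union> {Leg e x | e x. EdgeObj e \<in> int_objs G \<and> x \<in> e},
     Dom = (\<lambda>u. case u of Idn i \<Rightarrow> i | Leg e x \<Rightarrow> EdgeObj e),
     Cod = (\<lambda>u. case u of Idn i \<Rightarrow> i | Leg e x \<Rightarrow> VertObj x),
     Ident = Idn,
     Comp = (\<lambda>v u. case v of Idn i \<Rightarrow> u | Leg e x \<Rightarrow> v)\<rparr>"


section \<open>Structured decompositions\<close>

type_synonym ('o, 'm) gr_diagram = "(nat int_obj, nat int_arr, 'o, 'm) diagram"

definition structured_decomp ::
  "('o, 'm) cat \<Rightarrow> nat pair_pre_digraph set \<Rightarrow> nat pair_pre_digraph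
     \<Rightarrow> ('o, 'm) gr_diagram \<Rightarrow> bool" where
  "structured_decomp C \<G> G d \<longleftrightarrow>
     G \<in> \<G> \<and> is_functor (int_cat G) C d \<and> (\<forall>u \<in> Arr (int_cat G). monic C (arr_map d u))"

definition structured_decomp_of ::
  "('o, 'm) cat \<Rightarrow> nat pair_pre_digraph set \<Rightarrow> nat pair_pre_digraph
     \<Rightarrow> ('o, 'm) gr_diagram \<Rightarrow> 'o \<Rightarrow> bool" where
  "structured_decomp_of C \<G> G d X \<longleftrightarrow>
     structured_decomp C \<G> G d \<and>
     (\<exists>Z c. is_colimit_cocone (int_cat G) C d Z c \<and> iso_objs C X Z)"

definition is_completion ::
  "('o, 'm) cat \<Rightarrow> (nat \<Rightarrow> 'o set) \<Rightarrow> nat pair_pre_digraph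
     \<Rightarrow> ('o, 'm) gr_diagram \<Rightarrow> ('o, 'm) gr_diagram \<Rightarrow> (nat int_obj \<Rightarrow> 'm) \<Rightarrow> bool" where
  "is_completion C \<Omega> G d d' \<alpha> \<longleftrightarrow>
     is_nat_trans (int_cat G) C d d' \<alpha> \<and>
     (\<forall>x \<in> pverts G. obj_map d' (VertObj x) \<in> (\<Union>n. \<Omega> n) \<and> monic C (\<alpha> (VertObj x))) \<and>
     (\<forall>e. EdgeObj e \<in> Obj (int_cat G) \<longrightarrow>
        obj_map d' (EdgeObj e) = obj_map d (EdgeObj e) \<and>
        \<alpha> (EdgeObj e) = Ident C (obj_map d (EdgeObj e)))"

locale spined_sd_category = small_category C
  for C :: "('o, 'm) cat" (structure) +
  fixes \<G> :: "nat pair_pre_digraph set"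
    and \<Omega> :: "nat \<Rightarrow> 'o set"
  assumes shapes_are_graphs: "\<G> \<subseteq> Obj Gr"
    and one_vertex_shape: "complete_gr 1 \<in> \<G>"
    and W1: "structured_decomp C \<G> G d \<Longrightarrow> \<exists>X c. is_colimit_cocone (int_cat G) C d X c"
    and spine_objs: "\<Omega> n \<subseteq> Obj C"
    and spine_iso_closed: "\<lbrakk>X \<in> \<Omega> n; iso_objs C X Y\<rbrakk> \<Longrightarrow> Y \<in> \<Omega> n"
    and spine_filtered: "\<Omega> n \<subseteq> \<Omega> (Suc n)"
    and W2a: "X \<in> Obj C \<Longrightarrow> \<exists>W \<in> (\<Union>n. \<Omega> n). \<exists>f \<in> homset C X W. monic C f"
    and W2b: "\<lbrakk>n \<ge> 1; W \<in> \<Omega> n - \<Omega> (n - 1); Y \<in> \<Omega> (n - 1); f \<in> homset C W Y\<rbrakk>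
               \<Longrightarrow> \<not> monic C f"

locale width_category = spined_sd_category C \<G> \<Omega>
  for C :: "('o, 'm) cat" (structure) and \<G> \<Omega> +
  assumes pullbacks_of_monos:
      "\<lbrakk>monic C f; g \<in> Arr C; Cod C f = Cod C g\<rbrakk> \<Longrightarrow> \<exists>p q. is_pullback C f g p q"
    and W3_existence:
      "\<lbrakk>structured_decomp C \<G> G d; is_colimit_cocone (int_cat G) C d Y c;
        f \<in> homset C X Y; monic C f\<rbrakk>
       \<Longrightarrow> \<exists>d' p q. is_pullback_cocone (int_cat G) C d c f d' p q"
    and W3_colimit:
      "\<lbrakk>structured_decomp C \<G> G d; is_colimit_cocone (int_cat G) C d Y c;
        f \<in> homset C X Y; monic C f; is_pullback_cocone (int_cat G) C d c f d' p q\<rbrakk>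
       \<Longrightarrow> is_colimit_cocone (int_cat G) C d' X p"

locale complete_width_category = width_category C \<G> \<Omega>
  for C :: "('o, 'm) cat" (structure) and \<G> \<Omega> +
  assumes W4:
      "\<lbrakk>structured_decomp C \<G> G d; is_completion C \<Omega> G d d' \<alpha>;
        is_colimit_cocone (int_cat G) C d X c; is_colimit_cocone (int_cat G) C d' X' c';
        h \<in> homset C X X'; \<forall>i \<in> Obj (int_cat G). h \<cdot> c i = c' i \<cdot> \<alpha> i\<rbrakk>
       \<Longrightarrow> monic C h"


section \<open>Width and treewidth\<close>

definition spine_size :: "('o, 'm) cat \<Rightarrow> (nat \<Rightarrow> 'o set) \<Rightarrow> 'o \<Rightarrow> nat" where
  "spine_size C \<Omega> X = (LEAST n. \<exists>W \<in> \<Omega> n. \<exists>f \<in> homset C X W. monic C f)"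

text \<open>Widths are integers: the empty graph has width \<open>-1\<close>.\<close>
definition decomp_width ::
  "('o, 'm) cat \<Rightarrow> (nat \<Rightarrow> 'o set) \<Rightarrow> nat pair_pre_digraph \<Rightarrow> ('o, 'm) gr_diagram \<Rightarrow> int" where
  "decomp_width C \<Omega> G d =
     int (Max ((\<lambda>x. spine_size C \<Omega> (obj_map d (VertObj x))) ` pverts G)) - 1"

definition Gamma_width ::
  "('o, 'm) cat \<Rightarrow> nat pair_pre_digraph set \<Rightarrow> (nat \<Rightarrow> 'o set) \<Rightarrow> 'o \<Rightarrow> int" where
  "Gamma_width C \<G> \<Omega> X =
     (LEAST k. \<exists>G d. structured_decomp_of C \<G> G d X \<and> k = decomp_width C \<Omega> G d)"

definition rs_tree_decomp ::
  "'a pair_pre_digraph \<Rightarrow> 't pair_pre_digraph \<Rightarrow> ('t \<Rightarrow> 'a set) \<Rightarrow> bool" where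
  "rs_tree_decomp G T B \<longleftrightarrow>
     is_tree T \<and> (\<forall>t \<in> pverts T. B t \<subseteq> pverts G) \<and>
     (\<Union>t \<in> pverts T. B t) = pverts G \<and>
     (\<forall>(x, y) \<in> parcs G. \<exists>t \<in> pverts T. x \<in> B t \<and> y \<in> B t) \<and>
     (\<forall>t1 t2 t3 p. pre_digraph.apath (with_proj T) t1 p t3 \<and>
        t2 \<in> set (pre_digraph.awalk_verts (with_proj T) t1 p) \<longrightarrow> B t1 \<inter> B t3 \<subseteq> B t2)"

definition rs_width :: "'t pair_pre_digraph \<Rightarrow> ('t \<Rightarrow> 'a set) \<Rightarrow> int" where
  "rs_width T B = int (Max ((\<lambda>t. card (B t)) ` pverts T)) - 1"

definition treewidth :: "'a pair_pre_digraph \<Rightarrow> int" where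
  "treewidth G = (LEAST k. \<exists>T \<in> Trees. \<exists>B. rs_tree_decomp G T B \<and> k = rs_width T B)"

end

theory Submission
  imports Defs
begin

text \<open>
  Monomorphisms of graphs are the injective homomorphisms, and a cocone under a diagram
  \<open>int_cat T \<rightarrow> Gr\<close> is a colimit as soon as its legs jointly cover the vertices and the edges of the
  apex and two points of bags are identified only if a zigzag through edge objects (the relation
  \<open>glue\<close>) joins them. If \<open>T\<close> is a tree and the legs are injective, a zigzag that returns to its
  bag returns to its starting point; hence the bags embed into the quotient of their disjoint union,
  which is therefore loopless and a colimit. Hence colimits of structured decompositions are
  exactly such cocones, and (W3) and (W4) amount to lifting zigzags, along the pullback projections
  and along the completion respectively. The spine size of a graph is its number of vertices. The
  images of the bags of a structured decomposition form an RS-tree decomposition of the same width,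
  because zigzags project to walks and a walk in a tree passes through every vertex of
  the path between its ends; conversely the subgraphs induced on \<open>B t\<close> and on \<open>B s \<inter> B t\<close>
  form a structured decomposition.
\<close>

section \<open>Paths in trees\<close>

text \<open>The obstacle is that graphs have no loops: a diagram that forces two adjacent vertices
  together has no cocone in \<open>Gr\<close> at all. Over a cycle this happens, for instance with
  three bags \<open>complete_gr 2\<close> glued along \<open>complete_gr 2\<close> by identities and
  one swap. Over a tree it cannot, and the reason is one fact on trees,
  \<open>tree_neighbours_separated\<close>: deleting \<open>t\<close> separates the neighbours of
  \<open>t\<close> from each other. The same fact yields the path condition on RS-tree
  decompositions. The axioms quantify over all colimit cocones and all pullbacks, not only over
  constructed ones. Colimits are therefore described by the intrinsic conditions of
  \<open>glued_cocone\<close>, which are invariant under isomorphism, and an arbitrary pullback is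
  inspected through homomorphisms from \<open>complete_gr 1\<close> and
  \<open>complete_gr 2\<close>. Walks in \<open>T\<close> with \<open>t\<close> deleted appear
  throughout as reachability under \<open>avoiding T t\<close>.\<close>

definition avoiding :: "'a pair_pre_digraph \<Rightarrow> 'a \<Rightarrow> 'a rel" where
  "avoiding T t = {(x, y) \<in> parcs T. x \<noteq> t \<and> y \<noteq> t}"

lemma tree_sym:
  assumes "is_tree T" "(x, y) \<in> parcs T"
  shows "(y, x) \<in> parcs T"
proof -
  interpret pair_graph T using assms(1) by (simp add: is_tree_def)
  show ?thesis using assms(2) by (rule arcs_symmetric)
qed

lemma sym_avoiding:
  assumes "is_tree T"
  shows "sym (avoiding T t)"
  using tree_sym[OF assms] by (auto simp: avoiding_def sym_def)

text \<open>A path between two distinct neighbours of \<open>t\<close> that misses \<open>t\<close>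
  closes up through \<open>t\<close> to a cycle. This is the only use made of acyclicity.\<close>

lemma tree_neighbours_separated:
  assumes T: "is_tree T" and u: "(t, u) \<in> parcs T" and w: "(t, w) \<in> parcs T"
    and uw: "(u, w) \<in> (avoiding T t)\<^sup>*"
  shows "u = w"
proof (rule ccontr)
  assume neq: "u \<noteq> w"
  interpret T: pair_graph T using T by (simp add: is_tree_def)
  \<comment> \<open>\<open>H\<close> is \<open>T\<close> with \<open>t\<close> deleted, as a graph
    of its own, so that reachability in it yields a path with distinct vertices.\<close>
  define H where "H = \<lparr>pverts = pverts T - {t}, parcs = avoiding T t\<rparr>"
  have H_arcs: "parcs H \<subseteq> parcs T" "t \<notin> pverts H"
    by (auto simp: H_def avoiding_def)
  interpret H: pair_wf_digraph H
    by unfold_locales (auto simp: H_def avoiding_def dest: T.in_arcsD1 T.in_arcsD2)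
  have "u \<in> pverts H"
    using u T.in_arcsD2 T.no_loops' by (fastforce simp: H_def)
  from uw have "u \<rightarrow>\<^sup>*\<^bsub>with_proj H\<^esub> w"
  proof (induction)
    case base
    show ?case using \<open>u \<in> pverts H\<close> by simp
  next
    case (step y z)
    then have "(y, z) \<in> parcs H" by (simp add: H_def)
    with step.IH show ?case by (rule H.reachable_adj_trans)
  qed
  then obtain p where p: "H.apath u p w"
    using H.reachable_apath by blast
  have "set (pawalk_verts u p) \<subseteq> pverts H" "set p \<subseteq> parcs H" "pcas u p w"
    using H.awalkI_apath[OF p] unfolding H.awalk_conv by blast+
  then have "set p \<subseteq> parcs T" "t \<notin> set (pawalk_verts u p)" "pcas u p w"
    using H_arcs by blast+
  moreover have "distinct (pawalk_verts u p)"
    using p unfolding H.apath_def by blast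
  moreover have "p \<noteq> []"
    using p neq by (auto simp: H.apath_Nil_iff)
  moreover have "pawalk_verts u (p @ [(w, t)]) = pawalk_verts u p @ [t]"
    using \<open>pcas u p w\<close> by (induction p arbitrary: u) auto
  moreover have "pcas u (p @ [(w, t)]) t"
    using \<open>pcas u p w\<close> by (induction p arbitrary: u) auto
  \<comment> \<open>Two arcs at \<open>t\<close> and at least one arc of \<open>p\<close>, nonempty
    because \<open>u \<noteq> w\<close>, give the length 3 that \<open>is_tree\<close>
    forbids.\<close>
  ultimately have "T.awalk t ((t, u) # p @ [(w, t)]) t"
      "distinct (tl (pawalk_verts t ((t, u) # p @ [(w, t)])))"
      "3 \<le> length ((t, u) # p @ [(w, t)])"
    using u w tree_sym[OF T w] T.in_arcsD1 by (auto simp: T.awalk_def Suc_le_eq)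
  then show False
    using T unfolding is_tree_def T.cycle_def by blast
qed

lemma tree_path:
  assumes "is_tree T" "u \<in> pverts T" "v \<in> pverts T"
  obtains p where "pre_digraph.apath (with_proj T) u p v"
proof -
  interpret T: pair_graph T using assms by (simp add: is_tree_def)
  have "u \<rightarrow>\<^sup>*\<^bsub>with_proj T\<^esub> v"
    using T.symmetric_connected_imp_strongly_connected T.sym_arcs assms
    by (auto simp: is_tree_def strongly_connected_def)
  then show ?thesis
    using that T.reachable_apath by blast
qed

lemma walk_avoiding:
  assumes "pcas u p w" "set p \<subseteq> parcs T" "t \<notin> set (pawalk_verts u p)"
  shows "(u, w) \<in> (avoiding T t)\<^sup>*"
  using assms
proof (induction p arbitrary: u)
  case (Cons e p)
  have "snd e \<noteq> t" using Cons.prems by (cases p) auto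
  then have "(u, snd e) \<in> avoiding T t"
    using Cons.prems by (auto simp: avoiding_def)
  then show ?case
    using Cons by (auto intro: converse_rtrancl_into_rtrancl)
qed simp

text \<open>A path meets \<open>t\<close> only once, so the vertices before and after
  \<open>t\<close> on it are different neighbours of \<open>t\<close>. If \<open>r\<close> and
  \<open>s\<close> were connected off \<open>t\<close>, the remaining pieces of the path would
  connect these neighbours off \<open>t\<close> too.\<close>

lemma tree_path_separates:
  assumes T: "is_tree T" and p: "pre_digraph.apath (with_proj T) r p s"
    and t: "t \<in> set (pre_digraph.awalk_verts (with_proj T) r p)" "r \<noteq> t" "s \<noteq> t"
  shows "(r, s) \<notin> (avoiding T t)\<^sup>*"
proof
  assume rs: "(r, s) \<in> (avoiding T t)\<^sup>*"
  interpret T: pair_graph T using T by (simp add: is_tree_def)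
  have *: "pcas r p s" "set p \<subseteq> parcs T" "distinct (pawalk_verts r p)"
    "t \<in> set (pawalk_verts r p)"
    using p t by (auto simp: T.apath_def T.awalk_def)
  \<comment> \<open>\<open>u\<close> and \<open>w\<close> are the predecessor and the successor of
    \<open>t\<close>; the induction advances along the path until the next vertex is
    \<open>t\<close>.\<close>
  then have "\<exists>u w. (u, t) \<in> parcs T \<and> (t, w) \<in> parcs T \<and> u \<noteq> w \<and>
      (r, u) \<in> (avoiding T t)\<^sup>* \<and> (w, s) \<in> (avoiding T t)\<^sup>*"
    using t(2)
  proof (induction p arbitrary: r)
    case (Cons e p)
    show ?case
    proof (cases "snd e = t")
      case True
      with Cons.prems t(3) obtain f q where [simp]: "p = f # q" by (cases p) auto
      have "snd f \<in> set (pawalk_verts (snd f) q)" using Cons.prems by (cases q) auto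
      moreover have "(snd f, s) \<in> (avoiding T t)\<^sup>*"
        using Cons.prems True by (intro walk_avoiding[where p = q]) auto
      moreover have "(r, t) \<in> parcs T" "(t, snd f) \<in> parcs T"
        using Cons.prems True by (cases e; cases f; auto)+
      ultimately show ?thesis
        using Cons.prems by (intro exI[of _ r] exI[of _ "snd f"]) auto
    next
      case False
      then have "(r, snd e) \<in> avoiding T t"
        using Cons.prems by (auto simp: avoiding_def)
      moreover obtain u w where "(u, t) \<in> parcs T" "(t, w) \<in> parcs T" "u \<noteq> w"
        "(snd e, u) \<in> (avoiding T t)\<^sup>*" "(w, s) \<in> (avoiding T t)\<^sup>*"
        using Cons.IH[of "snd e"] Cons.prems False by auto
      ultimately show ?thesis
        by (meson converse_rtrancl_into_rtrancl)
    qed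
  qed simp
  then obtain u w where uw: "(u, t) \<in> parcs T" "(t, w) \<in> parcs T" "u \<noteq> w"
      "(r, u) \<in> (avoiding T t)\<^sup>*" "(w, s) \<in> (avoiding T t)\<^sup>*"
    by blast
  then have "(u, w) \<in> (avoiding T t)\<^sup>*"
    using rs sym_rtrancl[OF sym_avoiding[OF T]] by (meson rtrancl_trans symD)
  then show False
    using tree_neighbours_separated[OF T tree_sym[OF T uw(1)] uw(2)] uw(3) by blast
qed

text \<open>The pairs are points lying over the vertices of \<open>T\<close>, as for the relation
  \<open>glue\<close> later, and a chain that never meets the fibre over \<open>t\<close> projects
  to a walk off \<open>t\<close>. The lengths of the two pieces are recorded for the induction on
  length in \<open>glue_relpow_injective\<close>.\<close>

lemma relpow_visits_or_avoids:
  assumes "(p, q) \<in> R ^^ m" and "\<And>x y. (x, y) \<in> R \<Longrightarrow> (fst x, fst y) \<in> parcs T"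
  shows "(\<exists>r i j. (p, r) \<in> R ^^ i \<and> (r, q) \<in> R ^^ j \<and> i + j = m \<and> fst r = t)
    \<or> (fst p, fst q) \<in> (avoiding T t)\<^sup>*"
  using assms(1)
proof (induction m arbitrary: q)
  case 0
  then show ?case by auto
next
  case (Suc m)
  then obtain s where s: "(p, s) \<in> R ^^ m" "(s, q) \<in> R" by auto
  show ?case
  proof (cases "\<exists>r i j. (p, r) \<in> R ^^ i \<and> (r, s) \<in> R ^^ j \<and> i + j = m \<and> fst r = t")
    case True
    then obtain r i j where "(p, r) \<in> R ^^ i" "(r, s) \<in> R ^^ j" "i + j = m" "fst r = t"
      by blast
    then show ?thesis
      using s(2) by (intro disjI1 exI[of _ r] exI[of _ i] exI[of _ "Suc j"]) auto
  next
    case False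
    then have *: "(fst p, fst s) \<in> (avoiding T t)\<^sup>*" using Suc.IH s(1) by blast
    show ?thesis
    proof (cases "fst q = t")
      case True
      then show ?thesis
        using Suc.prems by (intro disjI1 exI[of _ q] exI[of _ "Suc m"] exI[of _ 0]) auto
    next
      case neq: False
      \<comment> \<open>Otherwise \<open>s\<close> itself would be a visit, with
        \<open>j = 0\<close>.\<close>
      have "fst s \<noteq> t" using False s(1) by (metis add.right_neutral relpow_0_I)
      then have "(fst s, fst q) \<in> avoiding T t"
        using neq assms(2)[OF s(2)] by (simp add: avoiding_def)
      then show ?thesis using * by (auto intro: rtrancl_into_rtrancl)
    qed
  qed
qed

section \<open>Pullback cocones and colimits in a category\<close>

context small_category
begin

lemma homset_Obj: "f \<in> homset C X Y \<Longrightarrow> X \<in> Obj C \<and> Y \<in> Obj C"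
  using Dom_in_Obj Cod_in_Obj by (auto simp: homset_def)

lemma iso_objs_sym: "iso_objs C X Y \<Longrightarrow> iso_objs C Y X"
  by (auto simp: iso_objs_def)

lemma iso_objs_trans:
  assumes "iso_objs C X Y" "iso_objs C Y Z"
  shows "iso_objs C X Z"
proof -
  obtain f g where f: "f \<in> homset C X Y" "g \<in> homset C Y X" "g \<cdot> f = Ident C X" "f \<cdot> g = Ident C Y"
    using assms(1) by (auto simp: iso_objs_def)
  obtain h k where h: "h \<in> homset C Y Z" "k \<in> homset C Z Y" "k \<cdot> h = Ident C Y" "h \<cdot> k = Ident C Z"
    using assms(2) by (auto simp: iso_objs_def)
  have hf: "h \<cdot> f \<in> homset C X Z" and gk: "g \<cdot> k \<in> homset C Z X"
    using Comp_in_homset f h by auto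
  have "(g \<cdot> k) \<cdot> (h \<cdot> f) = Ident C X"
    using Comp_assoc[OF hf h(2) f(2)] Comp_assoc[OF f(1) h(1,2)] Ident_Comp[OF f(1)] f h by simp
  moreover have "(h \<cdot> f) \<cdot> (g \<cdot> k) = Ident C Z"
    using Comp_assoc[OF gk f(1) h(1)] Comp_assoc[OF h(2) f(2,1)] Ident_Comp[OF h(2)] f h by simp
  ultimately show ?thesis
    using hf gk assms unfolding iso_objs_def by blast
qed

lemma cocone_post_compose:
  assumes "is_functor J C d" "is_cocone J C d X c" "h \<in> homset C X Y"
    and "\<And>u. u \<in> Arr J \<Longrightarrow> Dom J u \<in> Obj J \<and> Cod J u \<in> Obj J"
  shows "is_cocone J C d Y (\<lambda>i. h \<cdot> c i)"
  unfolding is_cocone_def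
proof (intro conjI ballI)
  show "Y \<in> Obj C" using assms(3) homset_Obj by blast
  fix i assume "i \<in> Obj J"
  then show "h \<cdot> c i \<in> homset C (obj_map d i) Y"
    using assms by (auto simp: is_cocone_def intro: Comp_in_homset)
next
  fix u assume u: "u \<in> Arr J"
  then have "arr_map d u \<in> homset C (obj_map d (Dom J u)) (obj_map d (Cod J u))"
      "c (Cod J u) \<in> homset C (obj_map d (Cod J u)) X" "c (Cod J u) \<cdot> arr_map d u = c (Dom J u)"
    using assms by (auto simp: is_cocone_def is_functor_def)
  then show "h \<cdot> c (Cod J u) \<cdot> arr_map d u = h \<cdot> c (Dom J u)"
    by (metis Comp_assoc[OF _ _ assms(3)])
qed

lemma colimit_endo_Ident:
  assumes "is_colimit_cocone J C d X c" "h \<in> homset C X X" "\<And>i. i \<in> Obj J \<Longrightarrow> h \<cdot> c i = c i"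
  shows "h = Ident C X"
proof -
  have "is_cocone J C d X c" using assms(1) by (simp add: is_colimit_cocone_def)
  then have "X \<in> Obj C" "\<forall>i \<in> Obj J. Ident C X \<cdot> c i = c i"
    using Ident_Comp by (auto simp: is_cocone_def)
  moreover have "\<exists>!h. h \<in> homset C X X \<and> (\<forall>i \<in> Obj J. h \<cdot> c i = c i)"
    using assms(1) \<open>is_cocone J C d X c\<close> by (simp add: is_colimit_cocone_def)
  ultimately show ?thesis
    using assms(2,3) Ident_in_homset by blast
qed

lemma colimit_unique:
  assumes X: "is_colimit_cocone J C d X c" and Y: "is_colimit_cocone J C d Y b"
  obtains h k where "h \<in> homset C X Y" "k \<in> homset C Y X" "h \<cdot> k = Ident C Y" "k \<cdot> h = Ident C X"
    "\<And>i. i \<in> Obj J \<Longrightarrow> h \<cdot> c i = b i" "\<And>i. i \<in> Obj J \<Longrightarrow> k \<cdot> b i = c i"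
proof -
  have cc: "is_cocone J C d X c" "is_cocone J C d Y b"
    using assms by (auto simp: is_colimit_cocone_def)
  have "\<exists>h. h \<in> homset C X Y \<and> (\<forall>i \<in> Obj J. h \<cdot> c i = b i)"
    using X cc(2) unfolding is_colimit_cocone_def by blast
  then obtain h where h: "h \<in> homset C X Y" "\<And>i. i \<in> Obj J \<Longrightarrow> h \<cdot> c i = b i"
    by blast
  have "\<exists>k. k \<in> homset C Y X \<and> (\<forall>i \<in> Obj J. k \<cdot> b i = c i)"
    using Y cc(1) unfolding is_colimit_cocone_def by blast
  then obtain k where k: "k \<in> homset C Y X" "\<And>i. i \<in> Obj J \<Longrightarrow> k \<cdot> b i = c i"
    by blast
  have ci: "c i \<in> homset C (obj_map d i) X" "b i \<in> homset C (obj_map d i) Y" if "i \<in> Obj J" for i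
    using cc that by (auto simp: is_cocone_def)
  have "k \<cdot> h = Ident C X"
    using colimit_endo_Ident[OF X Comp_in_homset[OF h(1) k(1)]] Comp_assoc[OF ci(1) h(1) k(1)] h k
    by simp
  moreover have "h \<cdot> k = Ident C Y"
    using colimit_endo_Ident[OF Y Comp_in_homset[OF k(1) h(1)]] Comp_assoc[OF ci(2) k(1) h(1)] h k
    by simp
  ultimately show ?thesis using that h k by simp
qed

lemma pullback_factor:
  assumes "is_pullback C f g p q" "p' \<in> homset C Z (Dom C f)" "q' \<in> homset C Z (Dom C g)"
    "f \<cdot> p' = g \<cdot> q'"
  shows "\<exists>!h. h \<in> homset C Z (Dom C p) \<and> p \<cdot> h = p' \<and> q \<cdot> h = q'"
  using assms unfolding is_pullback_def by blast

lemma pullback_unique_map: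
  assumes "is_pullback C f g p q" "h \<in> homset C Z (Dom C p)" "k \<in> homset C Z (Dom C p)"
    "p \<cdot> h = p \<cdot> k" "q \<cdot> h = q \<cdot> k"
  shows "h = k"
proof -
  have pq: "p \<in> homset C (Dom C p) (Dom C f)" "q \<in> homset C (Dom C p) (Dom C g)"
    "f \<in> homset C (Dom C f) (Cod C f)" "g \<in> homset C (Dom C g) (Cod C f)"
    using assms(1) by (auto simp: is_pullback_def homset_def)
  have "p \<cdot> h \<in> homset C Z (Dom C f)" "q \<cdot> h \<in> homset C Z (Dom C g)"
    using Comp_in_homset pq assms(2) by blast+
  moreover have "f \<cdot> (p \<cdot> h) = g \<cdot> (q \<cdot> h)"
    using Comp_assoc[OF assms(2) pq(1,3)] Comp_assoc[OF assms(2) pq(2,4)] assms(1)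
    by (simp add: is_pullback_def)
  ultimately have "\<exists>!l. l \<in> homset C Z (Dom C p) \<and> p \<cdot> l = p \<cdot> h \<and> q \<cdot> l = q \<cdot> h"
    by (rule pullback_factor[OF assms(1)])
  then show ?thesis using assms(2-) by auto
qed

text \<open>Pullbacks are chosen object by object; the universal property at \<open>Cod J u\<close>
  then determines the action on an arrow \<open>u\<close>, and its uniqueness part gives
  functoriality.\<close>

lemma pullback_cocone_exists:
  assumes J: "small_category J" and d: "is_functor J C d" and c: "is_cocone J C d Y c"
    and f: "f \<in> homset C X Y"
    and pb: "\<And>i. i \<in> Obj J \<Longrightarrow> \<exists>p q. is_pullback C f (c i) p q"
  shows "\<exists>d' p q. is_pullback_cocone J C d c f d' p q"
proof -
  interpret J: small_category J by fact
  obtain p q where pq: "\<And>i. i \<in> Obj J \<Longrightarrow> is_pullback C f (c i) (p i) (q i)"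
    using pb by metis
  have p: "p i \<in> homset C (Dom C (p i)) X" and q: "q i \<in> homset C (Dom C (p i)) (obj_map d i)"
    and ci: "c i \<in> homset C (obj_map d i) Y" and comm: "f \<cdot> p i = c i \<cdot> q i"
    and Dom_c: "Dom C f = X" "Dom C (c i) = obj_map d i"
    if "i \<in> Obj J" for i
    using pq[OF that] c f that by (auto simp: is_pullback_def homset_def is_cocone_def)
  have univ: "\<And>Z p' q'. p' \<in> homset C Z X \<Longrightarrow> q' \<in> homset C Z (obj_map d i) \<Longrightarrow>
      f \<cdot> p' = c i \<cdot> q' \<Longrightarrow> \<exists>!h. h \<in> homset C Z (Dom C (p i)) \<and> p i \<cdot> h = p' \<and> q i \<cdot> h = q'"
    if "i \<in> Obj J" for i
    using pullback_factor[OF pq[OF that]] Dom_c that by simp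
  \<comment> \<open>\<open>P u h\<close> collects the type and the two equations that
    \<open>is_pullback_cocone\<close> imposes on the image of \<open>u\<close>.\<close>
  define P where "P u h \<longleftrightarrow> h \<in> homset C (Dom C (p (Dom J u))) (Dom C (p (Cod J u))) \<and>
      p (Cod J u) \<cdot> h = p (Dom J u) \<and> q (Cod J u) \<cdot> h = arr_map d u \<cdot> q (Dom J u)" for u h
  have ex: "\<exists>h. P u h" if u: "u \<in> Arr J" for u
  proof -
    have D: "Dom J u \<in> Obj J" "Cod J u \<in> Obj J"
      using u J.Dom_in_Obj J.Cod_in_Obj by auto
    have du: "arr_map d u \<in> homset C (obj_map d (Dom J u)) (obj_map d (Cod J u))"
      using d u by (simp add: is_functor_def)
    \<comment> \<open>The cocone equation of \<open>c\<close> at \<open>u\<close> makes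
      \<open>p (Dom J u)\<close> and \<open>arr_map d u \<cdot> q (Dom J u)\<close> a compatible
      pair over the pullback square at \<open>Cod J u\<close>.\<close>
    have "c (Cod J u) \<cdot> (arr_map d u \<cdot> q (Dom J u)) = c (Dom J u) \<cdot> q (Dom J u)"
      using Comp_assoc[OF q[OF D(1)] du ci[OF D(2)]] c u by (simp add: is_cocone_def)
    then show ?thesis
      using univ[OF D(2) p[OF D(1)] Comp_in_homset[OF q[OF D(1)] du]] comm[OF D(1)]
      unfolding P_def by auto
  qed
  define d' where "d' = \<lparr>obj_map = (\<lambda>i. Dom C (p i)), arr_map = (\<lambda>u. SOME h. P u h)\<rparr>"
  have P: "P u (arr_map d' u)" if "u \<in> Arr J" for u
    using someI_ex[OF ex[OF that]] by (simp add: d'_def)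
  have obj [simp]: "obj_map d' i = Dom C (p i)" for i by (simp add: d'_def)
  have uniq: "P u h \<Longrightarrow> P u k \<Longrightarrow> u \<in> Arr J \<Longrightarrow> h = k" for u h k
    using pullback_unique_map[OF pq[OF J.Cod_in_Obj]] unfolding P_def by auto
  have "is_functor J C d'"
    unfolding is_functor_def
  proof (intro conjI ballI impI)
    fix i assume i: "i \<in> Obj J"
    show "obj_map d' i \<in> Obj C" using homset_Obj[OF p[OF i]] by simp
    have I: "Ident J i \<in> Arr J" "Dom J (Ident J i) = i" "Cod J (Ident J i) = i"
      using J.Ident_in_homset[OF i] by (auto simp: homset_def)
    have "P (Ident J i) (Ident C (Dom C (p i)))"
      using I i d p[OF i] q[OF i] homset_Obj[OF p[OF i]] Comp_Ident Ident_Comp Ident_in_homset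
      unfolding P_def by (auto simp: is_functor_def)
    then show "arr_map d' (Ident J i) = Ident C (obj_map d' i)"
      using uniq[OF P[OF I(1)] _ I(1)] by simp
  next
    fix u assume "u \<in> Arr J"
    then show "arr_map d' u \<in> homset C (obj_map d' (Dom J u)) (obj_map d' (Cod J u))"
      using P by (simp add: P_def)
  next
    fix u v assume uv: "u \<in> Arr J" "v \<in> Arr J" "Cod J u = Dom J v"
    then have vu: "v \<cdot>\<^bsub>J\<^esub> u \<in> Arr J" "Dom J (v \<cdot>\<^bsub>J\<^esub> u) = Dom J u" "Cod J (v \<cdot>\<^bsub>J\<^esub> u) = Cod J v"
      using J.Comp_in_homset[of u "Dom J u" "Cod J u" v "Cod J v"] by (auto simp: homset_def)
    have D: "Dom J u \<in> Obj J" "Dom J v \<in> Obj J" "Cod J v \<in> Obj J"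
      using uv J.Dom_in_Obj J.Cod_in_Obj by auto
    have u: "arr_map d' u \<in> homset C (Dom C (p (Dom J u))) (Dom C (p (Dom J v)))"
        "p (Dom J v) \<cdot> arr_map d' u = p (Dom J u)"
        "q (Dom J v) \<cdot> arr_map d' u = arr_map d u \<cdot> q (Dom J u)"
      using P[OF uv(1)] uv(3) by (auto simp: P_def)
    have v: "arr_map d' v \<in> homset C (Dom C (p (Dom J v))) (Dom C (p (Cod J v)))"
        "p (Cod J v) \<cdot> arr_map d' v = p (Dom J v)"
        "q (Cod J v) \<cdot> arr_map d' v = arr_map d v \<cdot> q (Dom J v)"
      using P[OF uv(2)] by (auto simp: P_def)
    have du: "arr_map d u \<in> homset C (obj_map d (Dom J u)) (obj_map d (Dom J v))"
        "arr_map d v \<in> homset C (obj_map d (Dom J v)) (obj_map d (Cod J v))"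
        "arr_map d (v \<cdot>\<^bsub>J\<^esub> u) = arr_map d v \<cdot> arr_map d u"
      using d uv by (auto simp: is_functor_def)
    have "p (Cod J v) \<cdot> (arr_map d' v \<cdot> arr_map d' u) = p (Dom J u)"
      using Comp_assoc[OF u(1) v(1) p[OF D(3)]] u v by simp
    moreover have "q (Cod J v) \<cdot> (arr_map d' v \<cdot> arr_map d' u)
        = (arr_map d v \<cdot> arr_map d u) \<cdot> q (Dom J u)"
      using Comp_assoc[OF u(1) v(1) q[OF D(3)]] Comp_assoc[OF u(1) q[OF D(2)] du(2)]
        Comp_assoc[OF q[OF D(1)] du(1,2)] u v by simp
    ultimately have "P (v \<cdot>\<^bsub>J\<^esub> u) (arr_map d' v \<cdot> arr_map d' u)"
      using Comp_in_homset[OF u(1) v(1)] vu du(3) by (simp add: P_def)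
    then show "arr_map d' (v \<cdot>\<^bsub>J\<^esub> u) = arr_map d' v \<cdot> arr_map d' u"
      by (rule uniq[OF P[OF vu(1)] _ vu(1)])
  qed
  then have "is_pullback_cocone J C d c f d' p q"
    using pq P by (simp add: is_pullback_cocone_def P_def)
  then show ?thesis by blast
qed

end

section \<open>The index category of a shape\<close>

lemma int_cat_simps [simp]:
  "Obj (int_cat T) = int_objs T"
  "Ident (int_cat T) = Idn"
  "Dom (int_cat T) (Idn i) = i"
  "Cod (int_cat T) (Idn i) = i"
  "Dom (int_cat T) (Leg e x) = EdgeObj e"
  "Cod (int_cat T) (Leg e x) = VertObj x"
  "Idn i \<cdot>\<^bsub>int_cat T\<^esub> u = u"
  "Leg e x \<cdot>\<^bsub>int_cat T\<^esub> u = Leg e x"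
  by (simp_all add: int_cat_def)

lemma int_objs_simps [simp]:
  "VertObj x \<in> int_objs T \<longleftrightarrow> x \<in> pverts T"
  "EdgeObj e \<in> int_objs T \<longleftrightarrow> (\<exists>x y. e = {x, y} \<and> (x, y) \<in> parcs T)"
  by (auto simp: int_objs_def)

lemma Arr_int_cat_simps [simp]:
  "Idn i \<in> Arr (int_cat T) \<longleftrightarrow> i \<in> int_objs T"
  "Leg e x \<in> Arr (int_cat T) \<longleftrightarrow> EdgeObj e \<in> int_objs T \<and> x \<in> e"
  by (auto simp: int_cat_def)

lemma small_category_int_cat:
  assumes "pair_graph T"
  shows "small_category (int_cat T)"
proof -
  interpret pair_graph T by fact
  have end_vert: "(x, y) \<in> parcs T \<Longrightarrow> x \<in> pverts T \<and> y \<in> pverts T" for x y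
    by (auto dest: in_arcsD1 in_arcsD2)
  show ?thesis
  proof
    fix u assume "u \<in> Arr (int_cat T)"
    then show "Dom (int_cat T) u \<in> Obj (int_cat T)" "Cod (int_cat T) u \<in> Obj (int_cat T)"
      by (cases u; use end_vert in auto)+
  next
    fix u v X Y Z
    assume "u \<in> homset (int_cat T) X Y" "v \<in> homset (int_cat T) Y Z"
    then show "v \<cdot>\<^bsub>int_cat T\<^esub> u \<in> homset (int_cat T) X Z"
      by (cases u; cases v) (auto simp: homset_def)
  next
    fix u X Y assume "u \<in> homset (int_cat T) X Y"
    then show "u \<cdot>\<^bsub>int_cat T\<^esub> Ident (int_cat T) X = u"
      by (cases u) (auto simp: homset_def)
  next
    fix u v w X Y Z W
    assume "u \<in> homset (int_cat T) W X" "v \<in> homset (int_cat T) X Y" "w \<in> homset (int_cat T) Y Z"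
    then show "w \<cdot>\<^bsub>int_cat T\<^esub> (v \<cdot>\<^bsub>int_cat T\<^esub> u) = w \<cdot>\<^bsub>int_cat T\<^esub> v \<cdot>\<^bsub>int_cat T\<^esub> u"
      by (cases w; simp)
  qed (auto simp: homset_def)
qed

section \<open>Homomorphisms, monomorphisms and cliques\<close>

definition app :: "gr_arrow \<Rightarrow> nat \<Rightarrow> nat" where
  "app m = fst (snd m)"

lemma app_triple [simp]: "app (X, f, Y) = f"
  by (simp add: app_def)

text \<open>The restriction makes the function extensional, as \<open>graph_hom\<close> demands, so
  that arrows can be given by arbitrary functions and compared on vertices.\<close>

abbreviation gr_arrow_of :: "nat pair_pre_digraph \<Rightarrow> (nat \<Rightarrow> nat) \<Rightarrow> nat pair_pre_digraph \<Rightarrow> gr_arrow" where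
  "gr_arrow_of X f Y \<equiv> (X, restrict f (pverts X), Y)"

lemma Obj_Gr: "X \<in> Obj Gr \<longleftrightarrow> pair_graph X \<and> (\<exists>n. pverts X = {..<n})"
  by (simp add: Gr_def)

lemma Obj_Gr_finite: "X \<in> Obj Gr \<Longrightarrow> finite (pverts X)"
  unfolding Obj_Gr by (metis finite_lessThan)

lemma Obj_GrD:
  assumes "X \<in> Obj Gr" "(x, y) \<in> parcs X"
  shows "x \<in> pverts X" "y \<in> pverts X" "x \<noteq> y" "(y, x) \<in> parcs X"
proof -
  interpret pair_graph X using assms(1) by (simp add: Obj_Gr)
  show "x \<in> pverts X" "y \<in> pverts X" "x \<noteq> y" "(y, x) \<in> parcs X"
    using in_arcsD1[OF assms(2)] in_arcsD2[OF assms(2)] no_loops'[OF assms(2)]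
      arcs_symmetric[OF assms(2)] by auto
qed

lemma pair_graphI:
  assumes "finite (pverts G)"
    and "\<And>x y. (x, y) \<in> parcs G \<Longrightarrow> x \<in> pverts G \<and> x \<noteq> y \<and> (y, x) \<in> parcs G"
  shows "pair_graph G"
proof -
  have v: "y \<in> pverts G" if "(x, y) \<in> parcs G" for x y
    using assms(2) that by blast
  have "parcs G \<subseteq> pverts G \<times> pverts G"
  proof (rule subrelI)
    fix x y assume "(x, y) \<in> parcs G"
    then show "(x, y) \<in> pverts G \<times> pverts G" using assms(2)[of x y] v[of x y] by simp
  qed
  then have fin: "finite (parcs G)" using assms(1) by (auto intro: finite_subset)
  show ?thesis
  proof
    show "symmetric (with_proj G)"
      unfolding symmetric_def with_proj_simps using assms(2) by (blast intro: symI)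
  next
    fix e assume e: "e \<in> parcs G"
    obtain x y where xy: "e = (x, y)" by (cases e)
    show "fst e \<in> pverts G" "snd e \<in> pverts G" "fst e \<noteq> snd e"
      using assms(2)[of x y] v[of x y] e xy by auto
  qed (fact assms(1) fin)+
qed

lemma homset_Gr:
  "m \<in> homset Gr X Y \<longleftrightarrow>
    X \<in> Obj Gr \<and> Y \<in> Obj Gr \<and> (\<exists>f \<in> graph_hom X Y. m = (X, f, Y))"
  by (auto simp: homset_def Gr_def)

lemma hom_vert: "m \<in> homset Gr X Y \<Longrightarrow> x \<in> pverts X \<Longrightarrow> app m x \<in> pverts Y"
  by (auto simp: homset_Gr graph_hom_def)

lemma hom_arc: "m \<in> homset Gr X Y \<Longrightarrow> (x, y) \<in> parcs X \<Longrightarrow> (app m x, app m y) \<in> parcs Y"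
  by (auto simp: homset_Gr graph_hom_def)

lemma gr_arrow_ofI:
  assumes "X \<in> Obj Gr" "Y \<in> Obj Gr" "\<And>x. x \<in> pverts X \<Longrightarrow> f x \<in> pverts Y"
    and "\<And>x y. (x, y) \<in> parcs X \<Longrightarrow> (f x, f y) \<in> parcs Y"
  shows "gr_arrow_of X f Y \<in> homset Gr X Y"
  using assms Obj_GrD(1,2)[OF assms(1)] by (auto simp: homset_Gr graph_hom_def)

lemma hom_eqI:
  assumes "m \<in> homset Gr X Y" "m' \<in> homset Gr X Y" "\<And>x. x \<in> pverts X \<Longrightarrow> app m x = app m' x"
  shows "m = m'"
proof -
  obtain f g where "m = (X, f, Y)" "m' = (X, g, Y)"
      "f \<in> pverts X \<rightarrow>\<^sub>E pverts Y" "g \<in> pverts X \<rightarrow>\<^sub>E pverts Y"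
    using assms(1,2) by (auto simp: homset_Gr graph_hom_def)
  moreover from this have "f = g"
    using assms(3) by (intro PiE_ext[of f _ _ g]) auto
  ultimately show ?thesis by simp
qed

lemma Comp_Gr_triple [simp]:
  "(Y', g, Z) \<cdot>\<^bsub>Gr\<^esub> (X, f, Y) = gr_arrow_of X (\<lambda>x. g (f x)) Z"
  by (simp add: Gr_def compose_def)

lemma app_Comp [simp]:
  assumes "f \<in> homset Gr X Y" "x \<in> pverts X"
  shows "app (g \<cdot>\<^bsub>Gr\<^esub> f) x = app g (app f x)"
proof -
  obtain f' where "f = (X, f', Y)" using assms(1) by (auto simp: homset_Gr)
  then show ?thesis using assms(2) by (cases g) simp
qed

lemma app_Ident [simp]: "x \<in> pverts X \<Longrightarrow> app (Ident Gr X) x = x"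
  by (simp add: Gr_def)

lemma Ident_Gr: "X \<in> Obj Gr \<Longrightarrow> Ident Gr X \<in> homset Gr X X"
  using gr_arrow_ofI[of X X id] by (simp add: Gr_def id_def)

lemma Comp_Gr:
  assumes f: "f \<in> homset Gr X Y" and g: "g \<in> homset Gr Y Z"
  shows "g \<cdot>\<^bsub>Gr\<^esub> f \<in> homset Gr X Z"
proof -
  have "gr_arrow_of X (\<lambda>x. app g (app f x)) Z \<in> homset Gr X Z"
    using assms hom_vert[OF f] hom_vert[OF g] hom_arc[OF f] hom_arc[OF g]
    by (intro gr_arrow_ofI) (auto simp: homset_Gr)
  moreover have "g \<cdot>\<^bsub>Gr\<^esub> f = gr_arrow_of X (\<lambda>x. app g (app f x)) Z"
    using assms by (auto simp: homset_Gr)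
  ultimately show ?thesis by simp
qed

lemma small_category_Gr: "small_category Gr"
proof
  show "f \<in> Arr Gr \<Longrightarrow> Dom Gr f \<in> Obj Gr" "f \<in> Arr Gr \<Longrightarrow> Cod Gr f \<in> Obj Gr" for f
    by (auto simp: Gr_def)
next
  fix f X Y assume f: "f \<in> homset Gr X Y"
  then have X: "X \<in> Obj Gr" "Y \<in> Obj Gr" by (auto simp: homset_Gr)
  show "f \<cdot>\<^bsub>Gr\<^esub> Ident Gr X = f"
    by (rule hom_eqI[OF Comp_Gr[OF Ident_Gr[OF X(1)] f] f])
      (simp add: app_Comp[OF Ident_Gr[OF X(1)]])
  show "Ident Gr Y \<cdot>\<^bsub>Gr\<^esub> f = f"
    by (rule hom_eqI[OF Comp_Gr[OF f Ident_Gr[OF X(2)]] f])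
      (simp add: app_Comp[OF f] hom_vert[OF f])
next
  fix f g h W X Y Z
  assume f: "f \<in> homset Gr W X" and g: "g \<in> homset Gr X Y" and h: "h \<in> homset Gr Y Z"
  show "h \<cdot>\<^bsub>Gr\<^esub> (g \<cdot>\<^bsub>Gr\<^esub> f) = h \<cdot>\<^bsub>Gr\<^esub> g \<cdot>\<^bsub>Gr\<^esub> f"
    by (rule hom_eqI[OF Comp_Gr[OF Comp_Gr[OF f g] h] Comp_Gr[OF f Comp_Gr[OF g h]]])
      (simp add: app_Comp[OF f] app_Comp[OF g] app_Comp[OF Comp_Gr[OF f g]] hom_vert[OF f])
qed (fact Ident_Gr Comp_Gr)+

interpretation Gr: small_category Gr
  by (rule small_category_Gr)

lemma complete_gr_Obj: "complete_gr n \<in> Obj Gr"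
  by (auto simp: Obj_Gr complete_gr_def intro!: pair_graphI)

text \<open>\<open>complete_gr 1\<close> represents the vertices of a graph, and
  \<open>complete_gr 2\<close> in the next lemma its arcs. Testing universal properties on these two
  graphs turns them into statements about vertices and arcs.\<close>

lemma point_hom:
  assumes "X \<in> Obj Gr" "x \<in> pverts X"
  shows "gr_arrow_of (complete_gr 1) (\<lambda>_. x) X \<in> homset Gr (complete_gr 1) X"
  using assms by (intro gr_arrow_ofI complete_gr_Obj) (auto simp: complete_gr_def)

lemma edge_hom:
  assumes "X \<in> Obj Gr" "(x, y) \<in> parcs X"
  shows "gr_arrow_of (complete_gr 2) (\<lambda>i. if i = 0 then x else y) X \<in> homset Gr (complete_gr 2) X"
  using assms Obj_GrD[OF assms]
  by (intro gr_arrow_ofI complete_gr_Obj) (auto simp: complete_gr_def)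

lemma hom_Dom_Cod: "m \<in> homset Gr X Y \<Longrightarrow> Dom Gr m = X \<and> Cod Gr m = Y \<and> m \<in> Arr Gr"
  by (simp add: homset_def)

text \<open>Two vertices with the same image give two homomorphisms from
  \<open>complete_gr 1\<close> with the same composite, so a monomorphism separates them. The
  converse holds because arrows are determined by their values on vertices.\<close>

lemma monic_Gr:
  assumes m: "m \<in> homset Gr X Y"
  shows "monic Gr m \<longleftrightarrow> inj_on (app m) (pverts X)"
proof
  assume mono: "monic Gr m"
  show "inj_on (app m) (pverts X)"
  proof (rule inj_onI)
    fix x y assume xy: "x \<in> pverts X" "y \<in> pverts X" "app m x = app m y"
    let ?p = "\<lambda>x. gr_arrow_of (complete_gr 1) (\<lambda>_. x) X"
    have p: "?p x \<in> homset Gr (complete_gr 1) X" "?p y \<in> homset Gr (complete_gr 1) X"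
      using point_hom xy m by (auto simp: homset_Gr)
    have "m \<cdot>\<^bsub>Gr\<^esub> ?p x = m \<cdot>\<^bsub>Gr\<^esub> ?p y"
      using xy by (intro hom_eqI[OF Gr.Comp_in_homset[OF p(1) m] Gr.Comp_in_homset[OF p(2) m]])
        (simp only: app_Comp[OF p(1)] app_Comp[OF p(2)] app_triple restrict_apply if_True)
    then have "?p x = ?p y"
      using mono p hom_Dom_Cod[OF m] unfolding monic_def by blast
    then have "app (?p x) 0 = app (?p y) 0" by simp
    then show "x = y" by (simp add: complete_gr_def)
  qed
next
  assume inj: "inj_on (app m) (pverts X)"
  show "monic Gr m"
    unfolding monic_def
  proof (intro conjI allI ballI impI)
    show "m \<in> Arr Gr" using hom_Dom_Cod[OF m] by simp
    fix Z f g assume "f \<in> homset Gr Z (Dom Gr m)" "g \<in> homset Gr Z (Dom Gr m)"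
    then have fg: "f \<in> homset Gr Z X" "g \<in> homset Gr Z X" using hom_Dom_Cod[OF m] by auto
    assume eq: "m \<cdot>\<^bsub>Gr\<^esub> f = m \<cdot>\<^bsub>Gr\<^esub> g"
    show "f = g"
    proof (rule hom_eqI[OF fg])
      fix z assume z: "z \<in> pverts Z"
      have "app m (app f z) = app m (app g z)"
        using app_Comp[OF fg(1) z, of m] app_Comp[OF fg(2) z, of m] eq by simp
      then show "app f z = app g z"
        using inj hom_vert[OF fg(1) z] hom_vert[OF fg(2) z] by (auto dest: inj_onD)
    qed
  qed
qed

text \<open>Objects of \<open>Gr\<close> live on initial segments of the naturals, whereas
  quotients, fibre products and induced subgraphs have classes, pairs or arbitrary subsets as
  vertices. This moves each of them into \<open>Gr\<close> along a bijection.\<close>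

lemma relabel:
  fixes H :: "'a pair_pre_digraph"
  assumes "finite (pverts H)"
    and H: "\<And>x y. (x, y) \<in> parcs H \<Longrightarrow> x \<in> pverts H \<and> x \<noteq> y \<and> (y, x) \<in> parcs H"
  obtains G h where "G \<in> Obj Gr" "bij_betw h (pverts G) (pverts H)"
    "\<And>i j. i \<in> pverts G \<Longrightarrow> j \<in> pverts G \<Longrightarrow> (i, j) \<in> parcs G \<longleftrightarrow> (h i, h j) \<in> parcs H"
proof -
  obtain h where h: "bij_betw h {0..<card (pverts H)} (pverts H)"
    using ex_bij_betw_nat_finite assms(1) by blast
  define G where "G = \<lparr>pverts = {..<card (pverts H)},
    parcs = {(i, j). i < card (pverts H) \<and> j < card (pverts H) \<and> (h i, h j) \<in> parcs H}\<rparr>"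
  have "pair_graph G"
  proof (rule pair_graphI)
    fix i j assume "(i, j) \<in> parcs G"
    then show "i \<in> pverts G \<and> i \<noteq> j \<and> (j, i) \<in> parcs G"
      using H[of "h i" "h j"] by (auto simp: G_def)
  qed (simp add: G_def)
  then have "G \<in> Obj Gr" unfolding Obj_Gr by (auto simp: G_def)
  then show ?thesis
    by (rule that) (use h in \<open>auto simp: G_def lessThan_atLeast0\<close>)
qed

section \<open>Counting vertices: cliques and the spine\<close>

lemma iso_objs_card:
  assumes "iso_objs Gr X Y"
  shows "card (pverts X) = card (pverts Y)"
proof -
  obtain f g where fg: "f \<in> homset Gr X Y" "g \<in> homset Gr Y X"
      "g \<cdot>\<^bsub>Gr\<^esub> f = Ident Gr X" "f \<cdot>\<^bsub>Gr\<^esub> g = Ident Gr Y"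
    using assms by (auto simp: iso_objs_def)
  have "app g (app f x) = x" if "x \<in> pverts X" for x
    using app_Comp[OF fg(1) that, of g] fg(3) that by simp
  moreover have "app f (app g y) = y" if "y \<in> pverts Y" for y
    using app_Comp[OF fg(2) that, of f] fg(4) that by simp
  ultimately have "bij_betw (app f) (pverts X) (pverts Y)"
    using hom_vert[OF fg(1)] hom_vert[OF fg(2)]
    by (intro bij_betw_byWitness[where f' = "app g"]) auto
  then show ?thesis by (rule bij_betw_same_card)
qed

lemma monic_card_le:
  assumes "m \<in> homset Gr X Y" "monic Gr m"
  shows "card (pverts X) \<le> card (pverts Y)"
  using assms hom_vert[OF assms(1)] Obj_Gr_finite
  by (intro card_inj_on_le[where f = "app m"]) (auto simp: monic_Gr homset_Gr)

lemma iso_objs_refl: "X \<in> Obj Gr \<Longrightarrow> iso_objs Gr X X"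
  using Gr.Ident_in_homset[of X] Gr.Comp_Ident unfolding iso_objs_def by blast

lemma card_complete_gr [simp]: "card (pverts (complete_gr n)) = n"
  by (simp add: complete_gr_def)

text \<open>Isomorphic graphs have equally many vertices, so the \<open>m\<close> in the definition
  of \<open>clique_spine\<close> can only be the order of \<open>W\<close>. The levels of the spine
  are thereby distinguished by counting.\<close>

lemma clique_spine_iff:
  "W \<in> clique_spine n \<longleftrightarrow> card (pverts W) \<le> n \<and> iso_objs Gr W (complete_gr (card (pverts W)))"
proof
  assume "W \<in> clique_spine n"
  then obtain m where "m \<le> n" "iso_objs Gr W (complete_gr m)" by (auto simp: clique_spine_def)
  then show "card (pverts W) \<le> n \<and> iso_objs Gr W (complete_gr (card (pverts W)))"
    using iso_objs_card by fastforce
next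
  assume "card (pverts W) \<le> n \<and> iso_objs Gr W (complete_gr (card (pverts W)))"
  then show "W \<in> clique_spine n"
    by (auto simp: clique_spine_def iso_objs_def)
qed

lemma complete_gr_in_spine: "complete_gr n \<in> clique_spine n"
  by (simp add: clique_spine_iff iso_objs_refl complete_gr_Obj)

text \<open>The identity on vertices works: the vertex set is an initial segment, and the absence of
  loops sends arcs to arcs of the clique.\<close>

lemma monic_into_clique:
  assumes "X \<in> Obj Gr"
  shows "\<exists>m \<in> homset Gr X (complete_gr (card (pverts X))). monic Gr m"
proof -
  obtain n where "pverts X = {..<n}" using assms unfolding Obj_Gr by blast
  then have "x < card (pverts X)" if "x \<in> pverts X" for x using that by simp
  then have "gr_arrow_of X (\<lambda>x. x) (complete_gr (card (pverts X)))
      \<in> homset Gr X (complete_gr (card (pverts X)))"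
    using assms Obj_GrD(1-3)[OF assms]
    by (intro gr_arrow_ofI complete_gr_Obj) (auto simp: complete_gr_def)
  then show ?thesis
    by (intro bexI) (auto simp: monic_Gr inj_on_def)
qed

lemma spine_size_Gr:
  assumes "X \<in> Obj Gr"
  shows "spine_size Gr clique_spine X = card (pverts X)"
  unfolding spine_size_def
proof (rule Least_equality)
  show "\<exists>W \<in> clique_spine (card (pverts X)). \<exists>f \<in> homset Gr X W. monic Gr f"
    using monic_into_clique[OF assms] complete_gr_in_spine by blast
next
  fix n assume "\<exists>W \<in> clique_spine n. \<exists>f \<in> homset Gr X W. monic Gr f"
  then obtain W f where "W \<in> clique_spine n" "f \<in> homset Gr X W" "monic Gr f" by blast
  then show "card (pverts X) \<le> n"
    using monic_card_le[of f X W] by (simp add: clique_spine_iff)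
qed

section \<open>Colimits over trees\<close>

text \<open>This is the disjoint union of the bags, each point tagged with its vertex of the shape.
  Edge objects contribute no points, since a colimit identifies each point of theirs with its images
  in the two end bags.\<close>

definition bag_points ::
  "nat pair_pre_digraph \<Rightarrow> (nat pair_pre_digraph, gr_arrow) gr_diagram \<Rightarrow> (nat \<times> nat) set" where
  "bag_points T d = (SIGMA v : pverts T. pverts (obj_map d (VertObj v)))"

text \<open>One step of a zigzag: from one end bag of an edge to the other, through a common point
  of the edge object. As \<open>parcs\<close> of a graph holds both directions of an edge, the
  reflexive transitive closure is the equivalence relation generated by the diagram.\<close>

definition glue ::
  "nat pair_pre_digraph \<Rightarrow> (nat pair_pre_digraph, gr_arrow) gr_diagram \<Rightarrow> (nat \<times> nat) rel" where
  "glue T d = {((x, app (arr_map d (Leg {x, y} x)) z), (y, app (arr_map d (Leg {x, y} y)) z)) | x y z.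
     (x, y) \<in> parcs T \<and> z \<in> pverts (obj_map d (EdgeObj {x, y}))}"

text \<open>The concrete description of colimit cocones over \<open>int_cat T\<close> in \<open>Gr\<close>; for trees and
  diagrams of monomorphisms it characterizes them.\<close>
definition glued_cocone ::
  "nat pair_pre_digraph \<Rightarrow> (nat pair_pre_digraph, gr_arrow) gr_diagram \<Rightarrow> nat pair_pre_digraph
     \<Rightarrow> (nat int_obj \<Rightarrow> gr_arrow) \<Rightarrow> bool" where
  "glued_cocone T d X c \<longleftrightarrow> is_cocone (int_cat T) Gr d X c \<and>
     (\<forall>x \<in> pverts X. \<exists>(v, a) \<in> bag_points T d. app (c (VertObj v)) a = x) \<and>
     (\<forall>(x, y) \<in> parcs X. \<exists>v \<in> pverts T. \<exists>(a, b) \<in> parcs (obj_map d (VertObj v)).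
        app (c (VertObj v)) a = x \<and> app (c (VertObj v)) b = y) \<and>
     (\<forall>(v, a) \<in> bag_points T d. \<forall>(w, b) \<in> bag_points T d.
        app (c (VertObj v)) a = app (c (VertObj w)) b \<longrightarrow> ((v, a), (w, b)) \<in> (glue T d)\<^sup>*)"

lemma glued_coconeD:
  assumes "glued_cocone T d X c"
  shows "is_cocone (int_cat T) Gr d X c"
    and "x \<in> pverts X \<Longrightarrow> \<exists>v a. (v, a) \<in> bag_points T d \<and> app (c (VertObj v)) a = x"
    and "(x, y) \<in> parcs X \<Longrightarrow> \<exists>v a b. v \<in> pverts T \<and> (a, b) \<in> parcs (obj_map d (VertObj v)) \<and>
        app (c (VertObj v)) a = x \<and> app (c (VertObj v)) b = y"
    and "(v, a) \<in> bag_points T d \<Longrightarrow> (w, b) \<in> bag_points T d \<Longrightarrow>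
      app (c (VertObj v)) a = app (c (VertObj w)) b \<Longrightarrow> ((v, a), (w, b)) \<in> (glue T d)\<^sup>*"
  using assms unfolding glued_cocone_def by fast+

locale gr_decomp =
  fixes T :: "nat pair_pre_digraph" and d :: "(nat pair_pre_digraph, gr_arrow) gr_diagram"
  assumes T: "pair_graph T" and d: "is_functor (int_cat T) Gr d"
begin

lemma end_vert: "(x, y) \<in> parcs T \<Longrightarrow> x \<in> pverts T" "(x, y) \<in> parcs T \<Longrightarrow> y \<in> pverts T"
  and arc_sym: "(x, y) \<in> parcs T \<Longrightarrow> (y, x) \<in> parcs T"
  and arc_neq: "(x, y) \<in> parcs T \<Longrightarrow> x \<noteq> y"
proof -
  interpret T: pair_graph T by (rule T)
  show "(x, y) \<in> parcs T \<Longrightarrow> x \<in> pverts T" "(x, y) \<in> parcs T \<Longrightarrow> y \<in> pverts T"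
    "(x, y) \<in> parcs T \<Longrightarrow> (y, x) \<in> parcs T" "(x, y) \<in> parcs T \<Longrightarrow> x \<noteq> y"
    by (fact T.in_arcsD1 T.in_arcsD2 T.arcs_symmetric T.no_loops')+
qed

lemma Dom_Cod_int: "u \<in> Arr (int_cat T) \<Longrightarrow> Dom (int_cat T) u \<in> int_objs T \<and> Cod (int_cat T) u \<in> int_objs T"
  using small_category.Dom_in_Obj[OF small_category_int_cat[OF T]]
    small_category.Cod_in_Obj[OF small_category_int_cat[OF T]] by simp

lemma obj: "i \<in> int_objs T \<Longrightarrow> obj_map d i \<in> Obj Gr"
  using d by (simp add: is_functor_def)

lemma arr: "u \<in> Arr (int_cat T) \<Longrightarrow>
    arr_map d u \<in> homset Gr (obj_map d (Dom (int_cat T) u)) (obj_map d (Cod (int_cat T) u))"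
  using d by (simp add: is_functor_def)

lemma leg:
  assumes "(x, y) \<in> parcs T"
  shows "arr_map d (Leg {x, y} x) \<in> homset Gr (obj_map d (EdgeObj {x, y})) (obj_map d (VertObj x))"
    and "arr_map d (Leg {x, y} y) \<in> homset Gr (obj_map d (EdgeObj {x, y})) (obj_map d (VertObj y))"
  using arr[of "Leg {x, y} x"] arr[of "Leg {x, y} y"] assms by auto

lemma cocone_leg:
  assumes c: "is_cocone (int_cat T) Gr d X c" and "(x, y) \<in> parcs T"
  shows "c (VertObj x) \<cdot>\<^bsub>Gr\<^esub> arr_map d (Leg {x, y} x) = c (EdgeObj {x, y})"
    and "c (VertObj y) \<cdot>\<^bsub>Gr\<^esub> arr_map d (Leg {x, y} y) = c (EdgeObj {x, y})"
proof -
  have *: "c (Cod (int_cat T) u) \<cdot>\<^bsub>Gr\<^esub> arr_map d u = c (Dom (int_cat T) u)" if "u \<in> Arr (int_cat T)" for u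
    using c that by (simp add: is_cocone_def)
  have "Leg {x, y} x \<in> Arr (int_cat T)" "Leg {x, y} y \<in> Arr (int_cat T)"
    using assms(2) by auto
  from this[THEN *] show "c (VertObj x) \<cdot>\<^bsub>Gr\<^esub> arr_map d (Leg {x, y} x) = c (EdgeObj {x, y})"
    "c (VertObj y) \<cdot>\<^bsub>Gr\<^esub> arr_map d (Leg {x, y} y) = c (EdgeObj {x, y})"
    by simp_all
qed

lemma cocone_hom: "is_cocone (int_cat T) Gr d X c \<Longrightarrow> i \<in> int_objs T \<Longrightarrow> c i \<in> homset Gr (obj_map d i) X"
  by (simp add: is_cocone_def)

lemma glueE:
  assumes "(p, q) \<in> glue T d"
  obtains x y z where "(x, y) \<in> parcs T" "z \<in> pverts (obj_map d (EdgeObj {x, y}))"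
    "p = (x, app (arr_map d (Leg {x, y} x)) z)" "q = (y, app (arr_map d (Leg {x, y} y)) z)"
  using assms unfolding glue_def by blast

lemma glueI:
  assumes "(x, y) \<in> parcs T" "z \<in> pverts (obj_map d (EdgeObj {x, y}))"
  shows "((x, app (arr_map d (Leg {x, y} x)) z), (y, app (arr_map d (Leg {x, y} y)) z)) \<in> glue T d"
  using assms unfolding glue_def by blast

lemma glue_bag_points:
  assumes "(p, q) \<in> glue T d"
  shows "p \<in> bag_points T d" "q \<in> bag_points T d"
proof -
  obtain x y z where xy: "(x, y) \<in> parcs T" and z: "z \<in> pverts (obj_map d (EdgeObj {x, y}))"
    and "p = (x, app (arr_map d (Leg {x, y} x)) z)" "q = (y, app (arr_map d (Leg {x, y} y)) z)"
    using assms by (rule glueE)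
  then show "p \<in> bag_points T d" "q \<in> bag_points T d"
    using end_vert[OF xy] hom_vert[OF leg(1)[OF xy] z] hom_vert[OF leg(2)[OF xy] z]
    by (auto simp: bag_points_def)
qed

lemma glue_rtrancl_bag_points:
  "(p, q) \<in> (glue T d)\<^sup>* \<Longrightarrow> p \<in> bag_points T d \<Longrightarrow> q \<in> bag_points T d"
  by (induction rule: rtrancl_induct) (auto dest: glue_bag_points)

lemma sym_glue: "sym (glue T d)"
proof (rule symI)
  fix p q assume "(p, q) \<in> glue T d"
  then show "(q, p) \<in> glue T d"
  proof (rule glueE)
    fix x y z assume "(x, y) \<in> parcs T" "z \<in> pverts (obj_map d (EdgeObj {x, y}))"
      "p = (x, app (arr_map d (Leg {x, y} x)) z)" "q = (y, app (arr_map d (Leg {x, y} y)) z)"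
    then show ?thesis
      using glueI[OF arc_sym, of x y z] by (simp add: insert_commute)
  qed
qed

lemma cocone_glue_step:
  assumes c: "is_cocone (int_cat T) Gr d X c" and "(p, q) \<in> glue T d"
  shows "app (c (VertObj (fst p))) (snd p) = app (c (VertObj (fst q))) (snd q)"
  using assms(2)
proof (rule glueE)
  fix x y z assume xy: "(x, y) \<in> parcs T" and z: "z \<in> pverts (obj_map d (EdgeObj {x, y}))"
    and [simp]: "p = (x, app (arr_map d (Leg {x, y} x)) z)" "q = (y, app (arr_map d (Leg {x, y} y)) z)"
  show ?thesis
    using app_Comp[OF leg(1)[OF xy] z, of "c (VertObj x)"] app_Comp[OF leg(2)[OF xy] z, of "c (VertObj y)"]
      cocone_leg[OF c xy] by simp
qed

lemma cocone_glue:
  assumes c: "is_cocone (int_cat T) Gr d X c" and "(p, q) \<in> (glue T d)\<^sup>*"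
  shows "app (c (VertObj (fst p))) (snd p) = app (c (VertObj (fst q))) (snd q)"
  using assms(2) cocone_glue_step[OF c] by (induction rule: rtrancl_induct) auto

text \<open>The leg at an edge object factors through the leg at either end, so cocones need to be
  compared at vertex objects only.\<close>

lemma cocone_eqI:
  assumes c: "is_cocone (int_cat T) Gr d X c" and b: "is_cocone (int_cat T) Gr d Y b"
    and h: "h \<in> homset Gr X Y"
    and eq: "\<And>v. v \<in> pverts T \<Longrightarrow> h \<cdot>\<^bsub>Gr\<^esub> c (VertObj v) = b (VertObj v)" and i: "i \<in> int_objs T"
  shows "h \<cdot>\<^bsub>Gr\<^esub> c i = b i"
proof (cases i)
  case (EdgeObj e)
  with i obtain x y where e: "e = {x, y}" and xy: "(x, y) \<in> parcs T" by auto
  have "h \<cdot>\<^bsub>Gr\<^esub> c i = h \<cdot>\<^bsub>Gr\<^esub> (c (VertObj x) \<cdot>\<^bsub>Gr\<^esub> arr_map d (Leg e x))"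
    using cocone_leg(1)[OF c xy] EdgeObj e by simp
  also have "\<dots> = h \<cdot>\<^bsub>Gr\<^esub> c (VertObj x) \<cdot>\<^bsub>Gr\<^esub> arr_map d (Leg e x)"
    using cocone_hom[OF c, of "VertObj x"] end_vert(1)[OF xy] leg(1)[OF xy] h e
    by (intro Gr.Comp_assoc) auto
  also have "\<dots> = b i"
    using cocone_leg(1)[OF b xy] EdgeObj e eq end_vert(1)[OF xy] by simp
  finally show ?thesis .
qed (use i eq in auto)

text \<open>The mediating map sends \<open>x\<close> to the value of \<open>b\<close> at a chosen
  preimage \<open>r x\<close> in some bag. Two preimages are joined by a zigzag and every cocone is
  constant along zigzags, so the choice does not matter; edges of \<open>X\<close> come from bags,
  so edges are preserved.\<close>

lemma glued_cocone_imp_colimit: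
  assumes X: "glued_cocone T d X c"
  shows "is_colimit_cocone (int_cat T) Gr d X c"
  unfolding is_colimit_cocone_def
proof (intro conjI allI impI)
  show c: "is_cocone (int_cat T) Gr d X c" using X by (rule glued_coconeD)
  fix Y b assume b: "is_cocone (int_cat T) Gr d Y b"
  have XY: "X \<in> Obj Gr" "Y \<in> Obj Gr" using b c by (auto simp: is_cocone_def)
  have "\<exists>p. p \<in> bag_points T d \<and> app (c (VertObj (fst p))) (snd p) = x" if "x \<in> pverts X" for x
    using glued_coconeD(2)[OF X that] by auto
  then obtain r where r: "\<And>x. x \<in> pverts X \<Longrightarrow> r x \<in> bag_points T d"
      "\<And>x. x \<in> pverts X \<Longrightarrow> app (c (VertObj (fst (r x)))) (snd (r x)) = x"
    by metis
  define h where "h x = app (b (VertObj (fst (r x)))) (snd (r x))" for x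
  have h: "h (app (c (VertObj v)) a) = app (b (VertObj v)) a" if va: "(v, a) \<in> bag_points T d" for v a
  proof -
    let ?x = "app (c (VertObj v)) a"
    have x: "?x \<in> pverts X"
      using va hom_vert[OF cocone_hom[OF c]] by (auto simp: bag_points_def)
    have "(r ?x, (v, a)) \<in> (glue T d)\<^sup>*"
      using glued_coconeD(4)[OF X _ va, of "fst (r ?x)" "snd (r ?x)"] r[OF x] by simp
    from cocone_glue[OF b this] show ?thesis by (simp add: h_def)
  qed
  define H where "H = gr_arrow_of X h Y"
  have H: "H \<in> homset Gr X Y"
    unfolding H_def
  proof (rule gr_arrow_ofI[OF XY])
    fix x assume "x \<in> pverts X"
    then show "h x \<in> pverts Y"
      using r(1)[of x] hom_vert[OF cocone_hom[OF b]] by (auto simp: h_def bag_points_def)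
  next
    fix x y assume "(x, y) \<in> parcs X"
    then obtain v a a' where v: "v \<in> pverts T" "(a, a') \<in> parcs (obj_map d (VertObj v))"
      "app (c (VertObj v)) a = x" "app (c (VertObj v)) a' = y"
      using glued_coconeD(3)[OF X] by blast
    then have "(v, a) \<in> bag_points T d" "(v, a') \<in> bag_points T d"
      using Obj_GrD[OF obj v(2)] by (auto simp: bag_points_def)
    then show "(h x, h y) \<in> parcs Y"
      using h[of v a] h[of v a'] v hom_arc[OF cocone_hom[OF b] v(2)] by simp
  qed
  have Hc: "H \<cdot>\<^bsub>Gr\<^esub> c (VertObj v) = b (VertObj v)" if v: "v \<in> pverts T" for v
  proof (rule hom_eqI)
    have cv: "c (VertObj v) \<in> homset Gr (obj_map d (VertObj v)) X" using cocone_hom[OF c] v by simp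
    show "H \<cdot>\<^bsub>Gr\<^esub> c (VertObj v) \<in> homset Gr (obj_map d (VertObj v)) Y"
      by (rule Comp_Gr[OF cv H])
    show "b (VertObj v) \<in> homset Gr (obj_map d (VertObj v)) Y" using cocone_hom[OF b] v by simp
    fix a assume a: "a \<in> pverts (obj_map d (VertObj v))"
    show "app (H \<cdot>\<^bsub>Gr\<^esub> c (VertObj v)) a = app (b (VertObj v)) a"
      using app_Comp[OF cv a, of H] hom_vert[OF cv a] h[of v a] a v by (simp add: H_def bag_points_def)
  qed
  show "\<exists>!h. h \<in> homset Gr X Y \<and> (\<forall>i \<in> Obj (int_cat T). h \<cdot>\<^bsub>Gr\<^esub> c i = b i)"
  proof (intro ex1I conjI ballI)
    show "H \<in> homset Gr X Y" by (rule H)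
    show "H \<cdot>\<^bsub>Gr\<^esub> c i = b i" if "i \<in> Obj (int_cat T)" for i
      using cocone_eqI[OF c b H Hc] that by simp
    fix K assume K: "K \<in> homset Gr X Y \<and> (\<forall>i \<in> Obj (int_cat T). K \<cdot>\<^bsub>Gr\<^esub> c i = b i)"
    show "K = H"
    proof (rule hom_eqI[of _ X Y])
      fix x assume "x \<in> pverts X"
      then obtain v a where va: "v \<in> pverts T" "a \<in> pverts (obj_map d (VertObj v))"
          "app (c (VertObj v)) a = x"
        using glued_coconeD(2)[OF X, of x] by (auto simp: bag_points_def)
      have cv: "c (VertObj v) \<in> homset Gr (obj_map d (VertObj v)) X" using cocone_hom[OF c] va by simp
      show "app K x = app H x"
        using app_Comp[OF cv va(2), of H] app_Comp[OF cv va(2), of K] Hc[OF va(1)] K va by simp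
    qed (use H K in auto)
  qed
qed

text \<open>Invariance under isomorphism of the apex carries the description from the constructed
  colimit to every other one, and later from the colimit of a decomposition to the graph that it
  decomposes.\<close>

lemma glued_cocone_transfer:
  assumes X: "glued_cocone T d X c" and k: "k \<in> homset Gr X Y" and h: "h \<in> homset Gr Y X"
    and hk: "h \<cdot>\<^bsub>Gr\<^esub> k = Ident Gr X" and kh: "k \<cdot>\<^bsub>Gr\<^esub> h = Ident Gr Y"
    and b: "\<And>i. i \<in> int_objs T \<Longrightarrow> k \<cdot>\<^bsub>Gr\<^esub> c i = b i" "is_cocone (int_cat T) Gr d Y b"
  shows "glued_cocone T d Y b"
proof -
  note c = glued_coconeD(1)[OF X]
  have bk: "app (b (VertObj v)) a = app k (app (c (VertObj v)) a)"
    if "(v, a) \<in> bag_points T d" for v a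
    using app_Comp[OF cocone_hom[OF c], of "VertObj v" a k] b(1)[of "VertObj v"] that
    by (auto simp: bag_points_def)
  have k_h: "app k (app h y) = y" if "y \<in> pverts Y" for y
    using app_Comp[OF h that, of k] kh that by simp
  have h_k: "app h (app k x) = x" if "x \<in> pverts X" for x
    using app_Comp[OF k that, of h] hk that by simp
  have cX: "app (c (VertObj v)) a \<in> pverts X" if "(v, a) \<in> bag_points T d" for v a
    using hom_vert[OF cocone_hom[OF c]] that by (auto simp: bag_points_def)
  have "\<exists>(v, a) \<in> bag_points T d. app (b (VertObj v)) a = y" if y: "y \<in> pverts Y" for y
  proof -
    obtain v a where va: "(v, a) \<in> bag_points T d" "app (c (VertObj v)) a = app h y"
      using glued_coconeD(2)[OF X hom_vert[OF h y]] by blast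
    then show ?thesis using bk[OF va(1)] k_h[OF y] by (intro bexI[OF _ va(1)]) simp
  qed
  moreover have "\<exists>v \<in> pverts T. \<exists>(a, a') \<in> parcs (obj_map d (VertObj v)).
      app (b (VertObj v)) a = y \<and> app (b (VertObj v)) a' = y'" if yy: "(y, y') \<in> parcs Y" for y y'
  proof -
    have Y: "Y \<in> Obj Gr" using b(2) by (simp add: is_cocone_def)
    obtain v a a' where v: "v \<in> pverts T" "(a, a') \<in> parcs (obj_map d (VertObj v))"
        "app (c (VertObj v)) a = app h y" "app (c (VertObj v)) a' = app h y'"
      using glued_coconeD(3)[OF X hom_arc[OF h yy]] by blast
    then have "(v, a) \<in> bag_points T d" "(v, a') \<in> bag_points T d"
      using Obj_GrD[OF obj v(2)] by (auto simp: bag_points_def)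
    then show ?thesis
      using bk k_h Obj_GrD[OF Y yy] v by (intro bexI[OF _ v(1)] bexI[OF _ v(2)]) auto
  qed
  moreover have "((v, a), (w, a')) \<in> (glue T d)\<^sup>*"
    if "(v, a) \<in> bag_points T d" "(w, a') \<in> bag_points T d"
      "app (b (VertObj v)) a = app (b (VertObj w)) a'" for v a w a'
    using glued_coconeD(4)[OF X that(1,2)] bk[OF that(1)] bk[OF that(2)] that(3)
      h_k[OF cX[OF that(1)]] h_k[OF cX[OF that(2)]] by simp
  ultimately show ?thesis
    using b(2) unfolding glued_cocone_def by blast
qed

lemma colimit_imp_glued_cocone:
  assumes X: "glued_cocone T d X c" and Y: "is_colimit_cocone (int_cat T) Gr d Y b"
  shows "glued_cocone T d Y b"
proof -
  obtain h k where "h \<in> homset Gr X Y" "k \<in> homset Gr Y X" "h \<cdot>\<^bsub>Gr\<^esub> k = Ident Gr Y"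
    "k \<cdot>\<^bsub>Gr\<^esub> h = Ident Gr X" "\<And>i. i \<in> Obj (int_cat T) \<Longrightarrow> h \<cdot>\<^bsub>Gr\<^esub> c i = b i"
    using Gr.colimit_unique[OF glued_cocone_imp_colimit[OF X] Y] by metis
  then show ?thesis
    using Y by (intro glued_cocone_transfer[OF X]) (auto simp: is_colimit_cocone_def)
qed

end

context gr_decomp
begin

lemma arr_Idn: "i \<in> int_objs T \<Longrightarrow> arr_map d (Idn i) = Ident Gr (obj_map d i)"
  using d unfolding is_functor_def by fastforce

text \<open>The leg at an edge is forced to pass through an end. Since \<open>EdgeObj\<close> stores
  an unordered edge, some end \<open>r e\<close> is picked, and the hypothesis \<open>eq\<close>
  makes the pick irrelevant.\<close>

lemma cocone_from_vertices:
  assumes X: "X \<in> Obj Gr" and b: "\<And>v. v \<in> pverts T \<Longrightarrow> b v \<in> homset Gr (obj_map d (VertObj v)) X"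
    and eq: "\<And>x y. (x, y) \<in> parcs T \<Longrightarrow>
      b x \<cdot>\<^bsub>Gr\<^esub> arr_map d (Leg {x, y} x) = b y \<cdot>\<^bsub>Gr\<^esub> arr_map d (Leg {x, y} y)"
  obtains c where "is_cocone (int_cat T) Gr d X c" "\<And>v. c (VertObj v) = b v"
proof -
  define r :: "nat set \<Rightarrow> nat" where "r e = (SOME x. x \<in> e)" for e
  define c where "c i = (case i of VertObj v \<Rightarrow> b v | EdgeObj e \<Rightarrow> b (r e) \<cdot>\<^bsub>Gr\<^esub> arr_map d (Leg e (r e)))" for i
  have edge: "c (EdgeObj e) = b x \<cdot>\<^bsub>Gr\<^esub> arr_map d (Leg e x)"
    if "EdgeObj e \<in> int_objs T" "x \<in> e" for e x
  proof -
    obtain y z where yz: "e = {y, z}" "(y, z) \<in> parcs T" using \<open>EdgeObj e \<in> int_objs T\<close> by auto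
    then have "r e \<in> {y, z}" unfolding r_def by (metis insertI1 someI_ex)
    then show ?thesis using eq[OF yz(2)] \<open>x \<in> e\<close> yz(1) by (auto simp: c_def)
  qed
  have chom: "c i \<in> homset Gr (obj_map d i) X" if i: "i \<in> int_objs T" for i
  proof (cases i)
    case (VertObj v)
    then show ?thesis using b[of v] i by (simp add: c_def)
  next
    case (EdgeObj e)
    with i obtain x y where xy: "e = {x, y}" "(x, y) \<in> parcs T" by auto
    have "c (EdgeObj e) = b x \<cdot>\<^bsub>Gr\<^esub> arr_map d (Leg e x)"
      using edge[of e x] i EdgeObj xy by auto
    then show ?thesis
      using Comp_Gr[OF leg(1)[OF xy(2)] b[OF end_vert(1)[OF xy(2)]]] EdgeObj xy(1) by simp
  qed
  have "is_cocone (int_cat T) Gr d X c"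
    unfolding is_cocone_def
  proof (intro conjI ballI)
    show "X \<in> Obj Gr" by (rule X)
  next
    show "c i \<in> homset Gr (obj_map d i) X" if "i \<in> Obj (int_cat T)" for i
      using chom that by simp
  next
    fix u assume u: "u \<in> Arr (int_cat T)"
    show "c (Cod (int_cat T) u) \<cdot>\<^bsub>Gr\<^esub> arr_map d u = c (Dom (int_cat T) u)"
    proof (cases u)
      case (Idn i)
      then have i: "i \<in> int_objs T" using u by simp
      then show ?thesis using Idn arr_Idn[OF i] Gr.Comp_Ident[OF chom[OF i]] by simp
    next
      case (Leg e x)
      then show ?thesis using edge[of e x] u by (simp add: c_def)
    qed
  qed
  then show ?thesis by (rule that) (simp add: c_def)
qed

end

section \<open>Diagrams over trees: bags embed and colimits exist\<close>

locale gr_tree_decomp = gr_decomp +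
  assumes tree: "is_tree T" and monic_arr: "\<And>u. u \<in> Arr (int_cat T) \<Longrightarrow> monic Gr (arr_map d u)"
begin

lemma leg_inj:
  assumes "(x, y) \<in> parcs T"
  shows "inj_on (app (arr_map d (Leg {x, y} y))) (pverts (obj_map d (EdgeObj {x, y})))"
proof -
  have "Leg {x, y} y \<in> Arr (int_cat T)" using assms by auto
  from monic_arr[OF this] show ?thesis using monic_Gr[OF leg(2)[OF assms]] by simp
qed

lemma glue_arc: "(p, q) \<in> glue T d \<Longrightarrow> (fst p, fst q) \<in> parcs T"
  by (elim glueE) simp

text \<open>The tree vertices of \<open>(v, a)\<close> and \<open>p\<close> fix the edge, and
  injectivity of the leg into the bag of \<open>p\<close> fixes the point of the edge object; hence
  the other end is fixed as well.\<close>

lemma glue_step_unique: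
  assumes "((v, a), p) \<in> glue T d" "((v, b), p) \<in> glue T d"
  shows "a = b"
proof -
  obtain u z where z: "(v, u) \<in> parcs T" "z \<in> pverts (obj_map d (EdgeObj {v, u}))"
    "a = app (arr_map d (Leg {v, u} v)) z" "p = (u, app (arr_map d (Leg {v, u} u)) z)"
    using assms(1) by (elim glueE) simp
  obtain z' where z': "z' \<in> pverts (obj_map d (EdgeObj {v, u}))"
    "b = app (arr_map d (Leg {v, u} v)) z'" "p = (u, app (arr_map d (Leg {v, u} u)) z')"
    using assms(2) z(4) by (elim glueE) simp
  show ?thesis
    using inj_onD[OF leg_inj[OF z(1)] _ z(2) z'(1)] z z' by simp
qed

text \<open>A shortest chain of gluing steps between two points of the bag at \<open>v\<close> cannot revisit \<open>v\<close>, so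
  it leaves and re-enters \<open>v\<close> through the same edge of the tree.\<close>
lemma glue_relpow_injective:
  "((v, a), (v, b)) \<in> glue T d ^^ n \<Longrightarrow> a = b"
proof (induction n arbitrary: v a b rule: less_induct)
  case (less n)
  show ?case
  proof (cases n)
    case 0
    then show ?thesis using less.prems by simp
  next
    case (Suc m)
    then obtain p where p: "((v, a), p) \<in> glue T d" "(p, (v, b)) \<in> glue T d ^^ m"
      using less.prems relpow_Suc_D2 by metis
    \<comment> \<open>A gluing step moves to a neighbouring vertex, so a returning chain has
      separate first and last steps, with \<open>k\<close> steps between them.\<close>
    have "fst p \<noteq> v" using glue_arc[OF p(1)] arc_neq by fastforce
    then obtain k where k: "m = Suc k" using p(2) by (cases m) auto
    then obtain q where q: "(p, q) \<in> glue T d ^^ k" "(q, (v, b)) \<in> glue T d"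
      using p(2) by auto
    consider (visits) r i j where "(p, r) \<in> glue T d ^^ i" "(r, q) \<in> glue T d ^^ j" "i + j = k" "fst r = v"
      | (avoids) "(fst p, fst q) \<in> (avoiding T v)\<^sup>*"
      using relpow_visits_or_avoids[OF q(1) glue_arc, where t = v] by blast
    then show ?thesis
    proof cases
      case visits
      then obtain c where r: "r = (v, c)" by (cases r) auto
      \<comment> \<open>The visit cuts the chain into two shorter closed ones, which give
        \<open>a = c\<close> and \<open>c = b\<close>.\<close>
      have "((v, a), (v, c)) \<in> glue T d ^^ Suc i" "((v, c), (v, b)) \<in> glue T d ^^ Suc j"
        using visits r p(1) q(2) relpow_Suc_I2 by (metis, metis relpow_Suc_I)
      moreover have "Suc i < n" "Suc j < n" using Suc k visits(3) by auto
      ultimately show ?thesis using less.IH by metis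
    next
      case avoids
      \<comment> \<open>The inner chain stays off \<open>v\<close>, so \<open>p\<close> and
        \<open>q\<close> lie in the same neighbouring bag; its length \<open>k\<close> is below
        \<open>n\<close>, and induction gives \<open>p = q\<close>.\<close>
      have "(v, fst p) \<in> parcs T" "(v, fst q) \<in> parcs T"
        using glue_arc[OF p(1)] arc_sym[OF glue_arc[OF q(2)]] by auto
      then have "fst p = fst q" using tree_neighbours_separated[OF tree] avoids by blast
      then have "p = q" using less.IH[of k "fst p" "snd p" "snd q"] q(1) Suc k by (cases p; cases q) simp
      then show ?thesis using glue_step_unique p(1) q(2) sym_glue by (blast dest: symD)
    qed
  qed
qed

lemma glue_injective: "((v, a), (v, b)) \<in> (glue T d)\<^sup>* \<Longrightarrow> a = b"
  using glue_relpow_injective by (auto simp: rtrancl_power)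

lemma glued_cocone_exists:
  obtains X c where "glued_cocone T d X c"
proof -
  define cls where "cls p = (glue T d)\<^sup>* `` {p}" for p
  have cls_eq: "cls p = cls q \<longleftrightarrow> (p, q) \<in> (glue T d)\<^sup>*" for p q
    using equiv_class_eq_iff[of UNIV "(glue T d)\<^sup>*" p q] sym_rtrancl[OF sym_glue]
    unfolding cls_def by (auto simp: equiv_def refl_on_def trans_rtrancl)
  \<comment> \<open>The quotient graph on classes of bag points; two classes are adjacent when some
    bag contains adjacent representatives.\<close>
  define H where "H = \<lparr>pverts = cls ` bag_points T d,
    parcs = {(cls (v, a), cls (v, b)) | v a b. v \<in> pverts T \<and> (a, b) \<in> parcs (obj_map d (VertObj v))}\<rparr>"
  have finT: "finite (pverts T)"
  proof -
    interpret T: pair_graph T by (rule T)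
    show ?thesis by (rule T.pair_finite_verts)
  qed
  then have finH: "finite (pverts H)"
    using Obj_Gr_finite[OF obj] by (auto simp: H_def bag_points_def)
  have arcH: "x \<in> pverts H \<and> x \<noteq> y \<and> (y, x) \<in> parcs H" if "(x, y) \<in> parcs H" for x y
  proof -
    obtain v a b where vab: "x = cls (v, a)" "y = cls (v, b)" "v \<in> pverts T" "(a, b) \<in> parcs (obj_map d (VertObj v))"
      using \<open>(x, y) \<in> parcs H\<close> by (auto simp: H_def)
    then have ab: "a \<in> pverts (obj_map d (VertObj v))" "a \<noteq> b" "(b, a) \<in> parcs (obj_map d (VertObj v))"
      using Obj_GrD[OF obj vab(4)] by auto
    \<comment> \<open>Here the tree shape and the monomorphisms enter, through
      \<open>glue_injective\<close>: adjacent points of a bag stay in different classes, so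
      \<open>H\<close> has no loop.\<close>
    then have "(v, a) \<in> bag_points T d" "((v, a), (v, b)) \<notin> (glue T d)\<^sup>*"
      using glue_injective[of v a b] vab(3) by (auto simp: bag_points_def)
    then have "x \<in> pverts H" "x \<noteq> y"
      unfolding vab(1,2) cls_eq by (auto simp: H_def)
    moreover have "(y, x) \<in> parcs H"
      using vab ab(3) unfolding H_def by auto
    ultimately show ?thesis by blast
  qed
  obtain G h where G: "G \<in> Obj Gr" and h: "bij_betw h (pverts G) (pverts H)"
    and arcG: "\<And>i j. i \<in> pverts G \<Longrightarrow> j \<in> pverts G \<Longrightarrow> (i, j) \<in> parcs G \<longleftrightarrow> (h i, h j) \<in> parcs H"
    using relabel[OF finH arcH] by blast
  define g where "g = inv_into (pverts G) h"
  have g: "g x \<in> pverts G" "h (g x) = x" if "x \<in> pverts H" for x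
    using bij_betw_inv_into_right[OF h that] bij_betw_apply[OF bij_betw_inv_into[OF h] that]
    by (simp_all add: g_def)
  have hG: "h i \<in> pverts H" "g (h i) = i" if "i \<in> pverts G" for i
    using bij_betw_inv_into_left[OF h that] bij_betw_apply[OF h that] by (simp_all add: g_def)
  have clsH: "cls p \<in> pverts H" if "p \<in> bag_points T d" for p using that by (simp add: H_def)
  have pt: "(v, a) \<in> bag_points T d \<longleftrightarrow> v \<in> pverts T \<and> a \<in> pverts (obj_map d (VertObj v))" for v a
    by (simp add: bag_points_def)
  define b where "b v = gr_arrow_of (obj_map d (VertObj v)) (\<lambda>a. g (cls (v, a))) G" for v
  have app_b: "app (b v) a = g (cls (v, a))" if "(v, a) \<in> bag_points T d" for v a
    using that by (simp add: b_def pt)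
  have bhom: "b v \<in> homset Gr (obj_map d (VertObj v)) G" if v: "v \<in> pverts T" for v
    unfolding b_def
  proof (rule gr_arrow_ofI)
    show "obj_map d (VertObj v) \<in> Obj Gr" using obj v by simp
    show "g (cls (v, a)) \<in> pverts G" if "a \<in> pverts (obj_map d (VertObj v))" for a
      using g(1) clsH pt v that by simp
    fix a a' assume aa: "(a, a') \<in> parcs (obj_map d (VertObj v))"
    then have "(v, a) \<in> bag_points T d" "(v, a') \<in> bag_points T d"
      using Obj_GrD[OF obj aa] v by (auto simp: pt)
    moreover have "(cls (v, a), cls (v, a')) \<in> parcs H" using aa v by (auto simp: H_def)
    ultimately show "(g (cls (v, a)), g (cls (v, a'))) \<in> parcs G"
      using g clsH arcG by simp
  qed (rule G)
  have eq: "b x \<cdot>\<^bsub>Gr\<^esub> arr_map d (Leg {x, y} x) = b y \<cdot>\<^bsub>Gr\<^esub> arr_map d (Leg {x, y} y)"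
    if xy: "(x, y) \<in> parcs T" for x y
  proof (rule hom_eqI[OF Comp_Gr[OF leg(1)[OF xy] bhom[OF end_vert(1)[OF xy]]]
        Comp_Gr[OF leg(2)[OF xy] bhom[OF end_vert(2)[OF xy]]]])
    fix z assume z: "z \<in> pverts (obj_map d (EdgeObj {x, y}))"
    note step = glueI[OF xy z]
    have "cls (x, app (arr_map d (Leg {x, y} x)) z) = cls (y, app (arr_map d (Leg {x, y} y)) z)"
      using step by (auto simp: cls_eq)
    then show "app (b x \<cdot>\<^bsub>Gr\<^esub> arr_map d (Leg {x, y} x)) z = app (b y \<cdot>\<^bsub>Gr\<^esub> arr_map d (Leg {x, y} y)) z"
      using app_Comp[OF leg(1)[OF xy] z] app_Comp[OF leg(2)[OF xy] z]
        app_b[OF glue_bag_points(1)[OF step]] app_b[OF glue_bag_points(2)[OF step]] by simp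
  qed
  obtain c where c: "is_cocone (int_cat T) Gr d G c" and cb: "\<And>v. c (VertObj v) = b v"
    using cocone_from_vertices[OF G bhom eq] by metis
  have "glued_cocone T d G c"
    unfolding glued_cocone_def
  proof (intro conjI)
    show "is_cocone (int_cat T) Gr d G c" by (rule c)
    show "\<forall>x \<in> pverts G. \<exists>(v, a) \<in> bag_points T d. app (c (VertObj v)) a = x"
    proof
      fix x assume x: "x \<in> pverts G"
      then obtain v a where va: "(v, a) \<in> bag_points T d" "h x = cls (v, a)"
        using hG(1)[OF x] by (auto simp: H_def)
      then have "app (c (VertObj v)) a = x" using app_b[OF va(1)] hG(2)[OF x] cb by simp
      then show "\<exists>(v, a) \<in> bag_points T d. app (c (VertObj v)) a = x"
        using va(1) by blast
    qed
    show "\<forall>(x, y) \<in> parcs G. \<exists>v \<in> pverts T. \<exists>(a, b) \<in> parcs (obj_map d (VertObj v)).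
        app (c (VertObj v)) a = x \<and> app (c (VertObj v)) b = y"
    proof clarify
      fix x y assume xy: "(x, y) \<in> parcs G"
      note xyG = Obj_GrD(1,2)[OF G xy]
      have "(h x, h y) \<in> parcs H" using arcG[OF xyG] xy by simp
      then obtain v a a' where v: "v \<in> pverts T" "(a, a') \<in> parcs (obj_map d (VertObj v))"
          "h x = cls (v, a)" "h y = cls (v, a')"
        by (auto simp: H_def)
      then have "(v, a) \<in> bag_points T d" "(v, a') \<in> bag_points T d"
        using Obj_GrD[OF obj v(2)] by (auto simp: pt)
      then have "app (c (VertObj v)) a = x \<and> app (c (VertObj v)) a' = y"
        using app_b[of v a] app_b[of v a'] v(3,4) hG(2)[OF xyG(1)] hG(2)[OF xyG(2)] cb by simp
      then show "\<exists>v \<in> pverts T. \<exists>(a, b) \<in> parcs (obj_map d (VertObj v)).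
          app (c (VertObj v)) a = x \<and> app (c (VertObj v)) b = y"
        using v(1,2) by blast
    qed
    show "\<forall>(v, a) \<in> bag_points T d. \<forall>(w, a') \<in> bag_points T d.
        app (c (VertObj v)) a = app (c (VertObj w)) a' \<longrightarrow> ((v, a), (w, a')) \<in> (glue T d)\<^sup>*"
    proof clarify
      fix v a w a' assume p: "(v, a) \<in> bag_points T d" "(w, a') \<in> bag_points T d"
        and eq: "app (c (VertObj v)) a = app (c (VertObj w)) a'"
      have "g (cls (v, a)) = g (cls (w, a'))"
        using eq unfolding cb app_b[OF p(1)] app_b[OF p(2)] .
      then have "cls (v, a) = cls (w, a')" 
        using g(2)[OF clsH[OF p(1)]] g(2)[OF clsH[OF p(2)]] by metis
      then show "((v, a), (w, a')) \<in> (glue T d)\<^sup>*" by (simp add: cls_eq)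
    qed
  qed
  then show ?thesis by (rule that)
qed

text \<open>One glued cocone exists and colimits are unique up to isomorphism, so the concrete
  description applies to any colimit cocone.\<close>

lemma colimit_glued:
  assumes "is_colimit_cocone (int_cat T) Gr d X c"
  shows "glued_cocone T d X c"
proof -
  obtain Y b where "glued_cocone T d Y b" by (rule glued_cocone_exists)
  from colimit_imp_glued_cocone[OF this assms] show ?thesis .
qed

lemma glued_cocone_inj:
  assumes X: "glued_cocone T d X c" and v: "v \<in> pverts T"
  shows "inj_on (app (c (VertObj v))) (pverts (obj_map d (VertObj v)))"
proof (rule inj_onI)
  fix a b assume "a \<in> pverts (obj_map d (VertObj v))" "b \<in> pverts (obj_map d (VertObj v))"
    "app (c (VertObj v)) a = app (c (VertObj v)) b"
  then show "a = b"
    using glued_coconeD(4)[OF X, of v a v b] v glue_injective by (simp add: bag_points_def)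
qed

end

lemma structured_decomp_gr_tree_decomp:
  assumes "structured_decomp Gr Trees T d"
  shows "gr_tree_decomp T d"
  using assms by (auto simp: structured_decomp_def Trees_def is_tree_def gr_tree_decomp_def
      gr_decomp_def gr_tree_decomp_axioms_def)

section \<open>Pullbacks of graphs\<close>

text \<open>The usual fibre product: pairs of vertices with equal image, and pairs of arcs. A loop
  in it would project to a loop in \<open>X\<close>.\<close>

lemma Gr_pullback_exists:
  assumes f: "f \<in> homset Gr X Z" and g: "g \<in> homset Gr Y Z"
  shows "\<exists>p q. is_pullback Gr f g p q"
proof -
  have X: "X \<in> Obj Gr" and Y: "Y \<in> Obj Gr" using f g by (auto simp: homset_Gr)
  define H where "H = \<lparr>pverts = {(x, y). x \<in> pverts X \<and> y \<in> pverts Y \<and> app f x = app g y},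
    parcs = {((x, y), (x', y')). (x, x') \<in> parcs X \<and> (y, y') \<in> parcs Y \<and>
      app f x = app g y \<and> app f x' = app g y'}\<rparr>"
  have "pverts H \<subseteq> pverts X \<times> pverts Y" by (auto simp: H_def)
  then have finH: "finite (pverts H)"
    using Obj_Gr_finite[OF X] Obj_Gr_finite[OF Y] by (auto intro: finite_subset)
  have arcH: "s \<in> pverts H \<and> s \<noteq> t \<and> (t, s) \<in> parcs H" if st: "(s, t) \<in> parcs H" for s t
  proof -
    obtain x y x' y' where xy: "s = (x, y)" "t = (x', y')" "(x, x') \<in> parcs X" "(y, y') \<in> parcs Y"
        "app f x = app g y" "app f x' = app g y'"
      using st by (auto simp: H_def)
    show ?thesis
      unfolding xy(1,2) H_def using Obj_GrD[OF X xy(3)] Obj_GrD[OF Y xy(4)] xy(5,6) by simp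
  qed
  obtain P h where P: "P \<in> Obj Gr" and h: "bij_betw h (pverts P) (pverts H)"
    and arcP: "\<And>i j. i \<in> pverts P \<Longrightarrow> j \<in> pverts P \<Longrightarrow> (i, j) \<in> parcs P \<longleftrightarrow> (h i, h j) \<in> parcs H"
    using relabel[OF finH arcH] by blast
  have hP: "fst (h i) \<in> pverts X" "snd (h i) \<in> pverts Y" "app f (fst (h i)) = app g (snd (h i))"
    if "i \<in> pverts P" for i
    using bij_betw_apply[OF h that] by (auto simp: H_def)
  have arch: "(fst (h i), fst (h j)) \<in> parcs X" "(snd (h i), snd (h j)) \<in> parcs Y"
    if ij: "(i, j) \<in> parcs P" for i j
  proof -
    have "(h i, h j) \<in> parcs H" using arcP Obj_GrD(1,2)[OF P ij] ij by blast
    then show "(fst (h i), fst (h j)) \<in> parcs X" "(snd (h i), snd (h j)) \<in> parcs Y"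
      by (auto simp: H_def)
  qed
  define p where "p = gr_arrow_of P (\<lambda>i. fst (h i)) X"
  define q where "q = gr_arrow_of P (\<lambda>i. snd (h i)) Y"
  have p: "p \<in> homset Gr P X" and q: "q \<in> homset Gr P Y"
    unfolding p_def q_def using hP arch by (auto intro!: gr_arrow_ofI P X Y)
  have app_p: "app p i = fst (h i)" and app_q: "app q i = snd (h i)" if "i \<in> pverts P" for i
    using that by (simp_all add: p_def q_def)
  note DC = hom_Dom_Cod[OF f] hom_Dom_Cod[OF g] hom_Dom_Cod[OF p] hom_Dom_Cod[OF q]
  have "is_pullback Gr f g p q"
    unfolding is_pullback_def
  proof (intro conjI allI ballI impI)
    show "{f, g, p, q} \<subseteq> Arr Gr" "Cod Gr f = Cod Gr g" "Dom Gr p = Dom Gr q" "Cod Gr p = Dom Gr f"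
      "Cod Gr q = Dom Gr g" using DC by simp_all
    show "f \<cdot>\<^bsub>Gr\<^esub> p = g \<cdot>\<^bsub>Gr\<^esub> q"
    proof (rule hom_eqI[OF Comp_Gr[OF p f] Comp_Gr[OF q g]])
      fix i assume i: "i \<in> pverts P"
      show "app (f \<cdot>\<^bsub>Gr\<^esub> p) i = app (g \<cdot>\<^bsub>Gr\<^esub> q) i"
        unfolding app_Comp[OF p i] app_Comp[OF q i] app_p[OF i] app_q[OF i] by (rule hP(3)[OF i])
    qed
    fix W p' q' assume p'q': "p' \<in> homset Gr W (Dom Gr f)" "q' \<in> homset Gr W (Dom Gr g)"
      and eq: "f \<cdot>\<^bsub>Gr\<^esub> p' = g \<cdot>\<^bsub>Gr\<^esub> q'"
    have p': "p' \<in> homset Gr W X" and q': "q' \<in> homset Gr W Y" using p'q' DC by auto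
    have W: "W \<in> Obj Gr" using p' by (simp add: homset_Gr)
    have fg: "app f (app p' w) = app g (app q' w)" if w: "w \<in> pverts W" for w
      using app_Comp[OF p' w, of f] app_Comp[OF q' w, of g] eq by simp
    define k where "k w = inv_into (pverts P) h (app p' w, app q' w)" for w
    have pairH: "(app p' w, app q' w) \<in> pverts H" if w: "w \<in> pverts W" for w
      using fg[OF w] hom_vert[OF p' w] hom_vert[OF q' w] by (simp add: H_def)
    have k: "k w \<in> pverts P" "h (k w) = (app p' w, app q' w)" if "w \<in> pverts W" for w
      using bij_betw_inv_into_right[OF h pairH[OF that]]
        bij_betw_apply[OF bij_betw_inv_into[OF h] pairH[OF that]] by (simp_all add: k_def)
    let ?k = "gr_arrow_of W k P"
    have kh: "?k \<in> homset Gr W P"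
    proof (rule gr_arrow_ofI[OF W P k(1)])
      fix w w' assume ww: "(w, w') \<in> parcs W"
      note w = Obj_GrD(1,2)[OF W ww]
      have "((app p' w, app q' w), (app p' w', app q' w')) \<in> parcs H"
        using hom_arc[OF p' ww] hom_arc[OF q' ww] fg w by (simp add: H_def)
      then show "(k w, k w') \<in> parcs P"
        using arcP[OF k(1)[OF w(1)] k(1)[OF w(2)]] k(2)[OF w(1)] k(2)[OF w(2)] by simp
    qed
    have pk: "p \<cdot>\<^bsub>Gr\<^esub> ?k = p'"
    proof (rule hom_eqI[OF Comp_Gr[OF kh p] p'])
      fix w assume w: "w \<in> pverts W"
      show "app (p \<cdot>\<^bsub>Gr\<^esub> ?k) w = app p' w"
        unfolding app_Comp[OF kh w] using app_p[OF k(1)[OF w]] k(2)[OF w] w by simp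
    qed
    have qk: "q \<cdot>\<^bsub>Gr\<^esub> ?k = q'"
    proof (rule hom_eqI[OF Comp_Gr[OF kh q] q'])
      fix w assume w: "w \<in> pverts W"
      show "app (q \<cdot>\<^bsub>Gr\<^esub> ?k) w = app q' w"
        unfolding app_Comp[OF kh w] using app_q[OF k(1)[OF w]] k(2)[OF w] w by simp
    qed
    show "\<exists>!h. h \<in> homset Gr W (Dom Gr p) \<and> p \<cdot>\<^bsub>Gr\<^esub> h = p' \<and> q \<cdot>\<^bsub>Gr\<^esub> h = q'"
    proof (intro ex1I[of _ ?k] conjI)
      show "?k \<in> homset Gr W (Dom Gr p)" using kh DC by simp
      fix l assume "l \<in> homset Gr W (Dom Gr p) \<and> p \<cdot>\<^bsub>Gr\<^esub> l = p' \<and> q \<cdot>\<^bsub>Gr\<^esub> l = q'"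
      then have l: "l \<in> homset Gr W P" "p \<cdot>\<^bsub>Gr\<^esub> l = p'" "q \<cdot>\<^bsub>Gr\<^esub> l = q'" using DC by auto
      show "l = ?k"
      proof (rule hom_eqI[OF l(1) kh])
        fix w assume w: "w \<in> pverts W"
        note lw = hom_vert[OF l(1) w]
        have "h (app l w) = (app p' w, app q' w)"
          using app_Comp[OF l(1) w, of p] app_Comp[OF l(1) w, of q] l(2,3) app_p[OF lw] app_q[OF lw]
          by (simp add: prod_eq_iff)
        then have "h (app l w) = h (k w)" using k(2)[OF w] by simp
        then have "app l w = k w"
          using inj_onD[OF bij_betw_imp_inj_on[OF h] _ lw k(1)[OF w]] by simp
        then show "app l w = app ?k w" using w by simp
      qed
    qed (use pk qk in auto)
  qed
  then show ?thesis by blast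
qed

section \<open>Vertices and arcs of an arbitrary pullback\<close>

context
  fixes X Y Z f g p q P
  assumes pb: "is_pullback Gr f g p q" and f: "f \<in> homset Gr X Z" and g: "g \<in> homset Gr Y Z"
    and P: "Dom Gr p = P"
begin

lemma Gr_pullback_homs: "p \<in> homset Gr P X" "q \<in> homset Gr P Y"
  using pb P hom_Dom_Cod[OF f] hom_Dom_Cod[OF g] by (auto simp: is_pullback_def homset_def)

lemma Gr_pullback_commutes:
  assumes "z \<in> pverts P"
  shows "app f (app p z) = app g (app q z)"
  using app_Comp[OF Gr_pullback_homs(1) assms, of f] app_Comp[OF Gr_pullback_homs(2) assms, of g] pb
  by (simp add: is_pullback_def)

lemma Gr_pullback_factor:
  assumes "p' \<in> homset Gr W X" "q' \<in> homset Gr W Y" "f \<cdot>\<^bsub>Gr\<^esub> p' = g \<cdot>\<^bsub>Gr\<^esub> q'"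
  shows "\<exists>!h. h \<in> homset Gr W P \<and> p \<cdot>\<^bsub>Gr\<^esub> h = p' \<and> q \<cdot>\<^bsub>Gr\<^esub> h = q'"
  using Gr.pullback_factor[OF pb, of p' W q'] assms P hom_Dom_Cod[OF f] hom_Dom_Cod[OF g] by simp

text \<open>\<open>x\<close> and \<open>y\<close> are homomorphisms from
  \<open>complete_gr 1\<close> that agree in \<open>Z\<close>; the induced map into \<open>P\<close>
  picks out the required vertex.\<close>

lemma Gr_pullback_vert:
  assumes x: "x \<in> pverts X" and y: "y \<in> pverts Y" and xy: "app f x = app g y"
  shows "\<exists>z \<in> pverts P. app p z = x \<and> app q z = y"
proof -
  let ?K = "complete_gr 1"
  have K: "0 \<in> pverts ?K" by (simp add: complete_gr_def)
  have px: "gr_arrow_of ?K (\<lambda>_. x) X \<in> homset Gr ?K X" and py: "gr_arrow_of ?K (\<lambda>_. y) Y \<in> homset Gr ?K Y"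
    using point_hom x y f g by (auto simp: homset_Gr)
  have "f \<cdot>\<^bsub>Gr\<^esub> gr_arrow_of ?K (\<lambda>_. x) X = g \<cdot>\<^bsub>Gr\<^esub> gr_arrow_of ?K (\<lambda>_. y) Y"
  proof (rule hom_eqI[OF Comp_Gr[OF px f] Comp_Gr[OF py g]])
    fix i assume i: "i \<in> pverts ?K"
    show "app (f \<cdot>\<^bsub>Gr\<^esub> gr_arrow_of ?K (\<lambda>_. x) X) i = app (g \<cdot>\<^bsub>Gr\<^esub> gr_arrow_of ?K (\<lambda>_. y) Y) i"
      unfolding app_Comp[OF px i] app_Comp[OF py i] using i xy by simp
  qed
  from Gr_pullback_factor[OF px py this] obtain h where h: "h \<in> homset Gr ?K P"
      "p \<cdot>\<^bsub>Gr\<^esub> h = gr_arrow_of ?K (\<lambda>_. x) X" "q \<cdot>\<^bsub>Gr\<^esub> h = gr_arrow_of ?K (\<lambda>_. y) Y"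
    by blast
  have "app p (app h 0) = x" "app q (app h 0) = y"
    using app_Comp[OF h(1) K, of p] app_Comp[OF h(1) K, of q] h(2,3) K by simp_all
  then show ?thesis using hom_vert[OF h(1) K] by blast
qed

text \<open>Two vertices with equal projections are two factorizations of the same pair of
  homomorphisms from \<open>complete_gr 1\<close>.\<close>

lemma Gr_pullback_inj:
  assumes z: "z \<in> pverts P" and z': "z' \<in> pverts P" and eq: "app p z = app p z'" "app q z = app q z'"
  shows "z = z'"
proof -
  let ?K = "complete_gr 1" and ?k = "\<lambda>z. gr_arrow_of (complete_gr 1) (\<lambda>_. z) P"
  have K: "0 \<in> pverts ?K" by (simp add: complete_gr_def)
  have P_Obj: "P \<in> Obj Gr" using Gr_pullback_homs by (simp add: homset_Gr)
  have k: "?k z \<in> homset Gr ?K P" "?k z' \<in> homset Gr ?K P"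
    using point_hom[OF P_Obj] z z' by auto
  have "m \<cdot>\<^bsub>Gr\<^esub> ?k z = m \<cdot>\<^bsub>Gr\<^esub> ?k z'" if m: "m \<in> homset Gr P M" "app m z = app m z'" for m M
  proof (rule hom_eqI[OF Comp_Gr[OF k(1) m(1)] Comp_Gr[OF k(2) m(1)]])
    fix i assume i: "i \<in> pverts ?K"
    show "app (m \<cdot>\<^bsub>Gr\<^esub> ?k z) i = app (m \<cdot>\<^bsub>Gr\<^esub> ?k z') i"
      unfolding app_Comp[OF k(1) i] app_Comp[OF k(2) i] using i m(2) by simp
  qed
  from this[OF Gr_pullback_homs(1) eq(1)] this[OF Gr_pullback_homs(2) eq(2)]
  have "?k z = ?k z'"
    using Gr.pullback_unique_map[OF pb, of "?k z" ?K "?k z'"] k P by simp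
  then have "app (?k z) 0 = app (?k z') 0" by simp
  then show ?thesis using K by simp
qed

text \<open>The argument for vertices, with \<open>complete_gr 2\<close> as test graph. Lifting
  whole arcs is what lets the pulled back bags cover the edges of \<open>X\<close>.\<close>

lemma Gr_pullback_arc:
  assumes x: "(x, x') \<in> parcs X" and y: "(y, y') \<in> parcs Y"
    and xy: "app f x = app g y" "app f x' = app g y'"
  shows "\<exists>(z, z') \<in> parcs P. app p z = x \<and> app q z = y \<and> app p z' = x' \<and> app q z' = y'"
proof -
  let ?K = "complete_gr 2" and ?e = "\<lambda>x x' i. if i = 0 then x else x'"
  have K: "0 \<in> pverts ?K" "Suc 0 \<in> pverts ?K" "(0, Suc 0) \<in> parcs ?K" by (auto simp: complete_gr_def)
  have px: "gr_arrow_of ?K (?e x x') X \<in> homset Gr ?K X" and py: "gr_arrow_of ?K (?e y y') Y \<in> homset Gr ?K Y"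
    using edge_hom x y f g by (auto simp: homset_Gr)
  have "f \<cdot>\<^bsub>Gr\<^esub> gr_arrow_of ?K (?e x x') X = g \<cdot>\<^bsub>Gr\<^esub> gr_arrow_of ?K (?e y y') Y"
  proof (rule hom_eqI[OF Comp_Gr[OF px f] Comp_Gr[OF py g]])
    fix i assume i: "i \<in> pverts ?K"
    show "app (f \<cdot>\<^bsub>Gr\<^esub> gr_arrow_of ?K (?e x x') X) i = app (g \<cdot>\<^bsub>Gr\<^esub> gr_arrow_of ?K (?e y y') Y) i"
      unfolding app_Comp[OF px i] app_Comp[OF py i] using i xy by simp
  qed
  from Gr_pullback_factor[OF px py this] obtain h where h: "h \<in> homset Gr ?K P"
      "p \<cdot>\<^bsub>Gr\<^esub> h = gr_arrow_of ?K (?e x x') X" "q \<cdot>\<^bsub>Gr\<^esub> h = gr_arrow_of ?K (?e y y') Y"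
    by blast
  have "app p (app h 0) = x" "app q (app h 0) = y" "app p (app h (Suc 0)) = x'" "app q (app h (Suc 0)) = y'"
    using app_Comp[OF h(1) K(1), of p] app_Comp[OF h(1) K(1), of q]
      app_Comp[OF h(1) K(2), of p] app_Comp[OF h(1) K(2), of q] h(2,3) K by simp_all
  then show ?thesis using hom_arc[OF h(1) K(3)] by blast
qed

end

text \<open>To cover \<open>X\<close>, a vertex or arc of \<open>X\<close> is paired with one of a
  bag over its image in \<open>Y\<close>. To join two points with the same image in
  \<open>X\<close>, they are projected to \<open>d\<close> by \<open>q\<close>, joined there, and
  the zigzag is lifted back.\<close>

lemma (in gr_decomp) pullback_glued_cocone:
  assumes Y: "glued_cocone T d Y c" and f: "f \<in> homset Gr X Y"
    and pb: "is_pullback_cocone (int_cat T) Gr d c f d' p q"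
  shows "glued_cocone T d' X p"
proof -
  note c = glued_coconeD(1)[OF Y]
  have d': "is_functor (int_cat T) Gr d'" using pb by (simp add: is_pullback_cocone_def)
  interpret d': gr_decomp T d' using T d' by (rule gr_decomp.intro)
  have sq: "is_pullback Gr f (c i) (p i) (q i)" "Dom Gr (p i) = obj_map d' i" if "i \<in> int_objs T" for i
    using pb that by (auto simp: is_pullback_cocone_def)
  have pq: "p i \<in> homset Gr (obj_map d' i) X" "q i \<in> homset Gr (obj_map d' i) (obj_map d i)"
    if i: "i \<in> int_objs T" for i
    using Gr_pullback_homs[OF sq(1)[OF i] f cocone_hom[OF c i] sq(2)[OF i]] by auto
  note comm = Gr_pullback_commutes[OF sq(1) f cocone_hom[OF c] sq(2)]
  note vert = Gr_pullback_vert[OF sq(1) f cocone_hom[OF c] sq(2)]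
  note uniq = Gr_pullback_inj[OF sq(1) f cocone_hom[OF c] sq(2)]
  note arc = Gr_pullback_arc[OF sq(1) f cocone_hom[OF c] sq(2)]
  have p: "is_cocone (int_cat T) Gr d' X p"
    using f pq(1) pb by (auto simp: is_cocone_def is_pullback_cocone_def homset_Gr)
  have leg': "app (p (VertObj x)) (app (arr_map d' (Leg e x)) z) = app (p (EdgeObj e)) z \<and>
      app (q (VertObj x)) (app (arr_map d' (Leg e x)) z) = app (arr_map d (Leg e x)) (app (q (EdgeObj e)) z)"
    if e: "EdgeObj e \<in> int_objs T" "x \<in> e" and z: "z \<in> pverts (obj_map d' (EdgeObj e))" for e x z
  proof -
    have u: "Leg e x \<in> Arr (int_cat T)" using e by simp
    have l: "arr_map d' (Leg e x) \<in> homset Gr (obj_map d' (EdgeObj e)) (obj_map d' (VertObj x))"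
      using d'.arr[OF u] by simp
    have "p (Cod (int_cat T) (Leg e x)) \<cdot>\<^bsub>Gr\<^esub> arr_map d' (Leg e x) = p (Dom (int_cat T) (Leg e x)) \<and>
        q (Cod (int_cat T) (Leg e x)) \<cdot>\<^bsub>Gr\<^esub> arr_map d' (Leg e x)
          = arr_map d (Leg e x) \<cdot>\<^bsub>Gr\<^esub> q (Dom (int_cat T) (Leg e x))"
      using pb u unfolding is_pullback_cocone_def by blast
    then show ?thesis
      using app_Comp[OF l z, of "p (VertObj x)"] app_Comp[OF l z, of "q (VertObj x)"]
        app_Comp[OF pq(2)[OF e(1)] z, of "arr_map d (Leg e x)"] by simp
  qed
  \<comment> \<open>The invariant is that the lifted chain keeps one fixed image in
    \<open>X\<close>; this image is what the next point of an edge object is paired with.\<close>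
  have lift: "\<exists>z'. r \<in> bag_points T d \<and> z' \<in> pverts (obj_map d' (VertObj (fst r))) \<and>
      app (q (VertObj (fst r))) z' = snd r \<and> app (p (VertObj (fst r))) z' = app (p (VertObj v)) z \<and>
      ((v, z), (fst r, z')) \<in> (glue T d')\<^sup>*"
    if "((v, app (q (VertObj v)) z), r) \<in> (glue T d)\<^sup>*" "v \<in> pverts T"
      "z \<in> pverts (obj_map d' (VertObj v))" for v z r
    using that(1)
  proof (induction rule: rtrancl_induct)
    case base
    show ?case using that(2,3) hom_vert[OF pq(2), of "VertObj v" z] by (auto simp: bag_points_def)
  next
    case (step r s)
    let ?x = "app (p (VertObj v)) z"
    obtain w u y where wu: "(w, u) \<in> parcs T" and y: "y \<in> pverts (obj_map d (EdgeObj {w, u}))"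
      and r: "r = (w, app (arr_map d (Leg {w, u} w)) y)" and s: "s = (u, app (arr_map d (Leg {w, u} u)) y)"
      using step.hyps(2) by (rule glueE)
    obtain z' where z': "z' \<in> pverts (obj_map d' (VertObj w))" "app (q (VertObj w)) z' = snd r"
        "app (p (VertObj w)) z' = ?x" "((v, z), (w, z')) \<in> (glue T d')\<^sup>*"
      using step.IH r by auto
    have e: "EdgeObj {w, u} \<in> int_objs T" "VertObj w \<in> int_objs T" using wu end_vert(1)[OF wu] by auto
    have x: "?x \<in> pverts X" using hom_vert[OF pq(1)[OF e(2)] z'(1)] z'(3) by simp
    have "app (c (EdgeObj {w, u})) y = app (c (VertObj w)) (snd r)"
      using app_Comp[OF leg(1)[OF wu] y, of "c (VertObj w)"] cocone_leg(1)[OF c wu] r by simp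
    also have "\<dots> = app f ?x"
      using comm[OF e(2) e(2) e(2) z'(1)] z'(2,3) by simp
    \<comment> \<open>\<open>?x\<close> and \<open>y\<close> have the same image in
      \<open>Y\<close>, so the pullback at the edge object has a point over both.\<close>
    finally obtain t where t: "t \<in> pverts (obj_map d' (EdgeObj {w, u}))"
        "app (p (EdgeObj {w, u})) t = ?x" "app (q (EdgeObj {w, u})) t = y"
      using vert[OF e(1) e(1) e(1) x y] by metis
    \<comment> \<open>Both sides have the same two projections, so the lifted step starts exactly
      where the lifted chain ended.\<close>
    have t': "app (arr_map d' (Leg {w, u} w)) t = z'"
      using uniq[OF e(2) e(2) e(2) hom_vert[OF d'.leg(1)[OF wu] t(1)] z'(1)]
        leg'[OF e(1) _ t(1), of w] t(2,3) z'(2,3) r by simp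
    have "((w, z'), (u, app (arr_map d' (Leg {w, u} u)) t)) \<in> glue T d'"
      using d'.glueI[OF wu t(1)] t' by simp
    then have "((v, z), (u, app (arr_map d' (Leg {w, u} u)) t)) \<in> (glue T d')\<^sup>*"
      using z'(4) by (rule rtrancl_into_rtrancl[rotated])
    moreover have "app (p (VertObj u)) (app (arr_map d' (Leg {w, u} u)) t) = ?x"
        "app (q (VertObj u)) (app (arr_map d' (Leg {w, u} u)) t) = snd s"
      using leg'[OF e(1) _ t(1), of u] t(2,3) s by simp_all
    moreover have "s \<in> bag_points T d" by (rule glue_bag_points(2)[OF step.hyps(2)])
    ultimately show ?case
      using hom_vert[OF d'.leg(2)[OF wu] t(1)] s by auto
  qed
  show ?thesis
    unfolding glued_cocone_def
  proof (intro conjI)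
    show "is_cocone (int_cat T) Gr d' X p" by (rule p)
    show "\<forall>x \<in> pverts X. \<exists>(v, a) \<in> bag_points T d'. app (p (VertObj v)) a = x"
    proof
      fix x assume x: "x \<in> pverts X"
      obtain v a where va: "(v, a) \<in> bag_points T d" "app (c (VertObj v)) a = app f x"
        using glued_coconeD(2)[OF Y hom_vert[OF f x]] by blast
      then have v: "VertObj v \<in> int_objs T" "a \<in> pverts (obj_map d (VertObj v))"
        by (auto simp: bag_points_def)
      obtain z where "z \<in> pverts (obj_map d' (VertObj v))" "app (p (VertObj v)) z = x"
        using vert[OF v(1) v(1) v(1) x v(2)] va(2) by auto
      then show "\<exists>(v, a) \<in> bag_points T d'. app (p (VertObj v)) a = x"
        using v by (intro bexI[of _ "(v, z)"]) (auto simp: bag_points_def)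
    qed
    show "\<forall>(x, x') \<in> parcs X. \<exists>v \<in> pverts T. \<exists>(a, b) \<in> parcs (obj_map d' (VertObj v)).
        app (p (VertObj v)) a = x \<and> app (p (VertObj v)) b = x'"
    proof clarify
      fix x x' assume xx: "(x, x') \<in> parcs X"
      obtain v a b where v: "v \<in> pverts T" and ab: "(a, b) \<in> parcs (obj_map d (VertObj v))"
        "app (c (VertObj v)) a = app f x" "app (c (VertObj v)) b = app f x'"
        using glued_coconeD(3)[OF Y hom_arc[OF f xx]] by blast
      have v': "VertObj v \<in> int_objs T" using v by simp
      show "\<exists>v \<in> pverts T. \<exists>(a, b) \<in> parcs (obj_map d' (VertObj v)).
          app (p (VertObj v)) a = x \<and> app (p (VertObj v)) b = x'"
        using arc[OF v' v' v' xx ab(1)] ab(2,3) v by fastforce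
    qed
    show "\<forall>(v, a) \<in> bag_points T d'. \<forall>(w, b) \<in> bag_points T d'.
        app (p (VertObj v)) a = app (p (VertObj w)) b \<longrightarrow> ((v, a), (w, b)) \<in> (glue T d')\<^sup>*"
    proof clarify
      fix v a w b assume "(v, a) \<in> bag_points T d'" "(w, b) \<in> bag_points T d'"
        and eq: "app (p (VertObj v)) a = app (p (VertObj w)) b"
      then have v: "VertObj v \<in> int_objs T" "a \<in> pverts (obj_map d' (VertObj v))"
        and w: "VertObj w \<in> int_objs T" "b \<in> pverts (obj_map d' (VertObj w))"
        by (auto simp: bag_points_def)
      have "(v, app (q (VertObj v)) a) \<in> bag_points T d" "(w, app (q (VertObj w)) b) \<in> bag_points T d"
        using v w hom_vert[OF pq(2)[OF v(1)] v(2)] hom_vert[OF pq(2)[OF w(1)] w(2)]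
        by (auto simp: bag_points_def)
      moreover have "app (c (VertObj v)) (app (q (VertObj v)) a) = app (c (VertObj w)) (app (q (VertObj w)) b)"
        using comm[OF v(1) v(1) v(1) v(2)] comm[OF w(1) w(1) w(1) w(2)] eq by simp
      ultimately have "((v, app (q (VertObj v)) a), (w, app (q (VertObj w)) b)) \<in> (glue T d)\<^sup>*"
        by (rule glued_coconeD(4)[OF Y])
      from lift[OF this] v obtain b' where b': "b' \<in> pverts (obj_map d' (VertObj w))"
          "app (q (VertObj w)) b' = app (q (VertObj w)) b" "app (p (VertObj w)) b' = app (p (VertObj v)) a"
          "((v, a), (w, b')) \<in> (glue T d')\<^sup>*"
        by auto
      \<comment> \<open>The lift ends at \<open>b'\<close>, whose projections agree with those of
        \<open>b\<close>; hence \<open>b' = b\<close>.\<close>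
      then show "((v, a), (w, b)) \<in> (glue T d')\<^sup>*"
        using uniq[OF w(1) w(1) w(1) b'(1) w(2)] eq by simp
    qed
  qed
qed

section \<open>Completions\<close>

text \<open>A completion does not demand monomorphisms in \<open>d'\<close>. As
  \<open>\<alpha>\<close> is the identity at edge objects, naturality writes each leg of
  \<open>d'\<close> as a leg of \<open>d\<close> followed by a component of \<open>\<alpha>\<close>,
  both injective.\<close>

lemma completion_gr_tree_decomp:
  assumes d: "structured_decomp Gr Trees T d" and \<alpha>: "is_completion Gr \<Omega> T d d' \<alpha>"
  shows "gr_tree_decomp T d'"
proof -
  interpret d: gr_tree_decomp T d using structured_decomp_gr_tree_decomp[OF d] .
  have d': "is_functor (int_cat T) Gr d'" and nat: "\<And>i. i \<in> int_objs T \<Longrightarrow> \<alpha> i \<in> homset Gr (obj_map d i) (obj_map d' i)"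
    "\<And>u. u \<in> Arr (int_cat T) \<Longrightarrow> \<alpha> (Cod (int_cat T) u) \<cdot>\<^bsub>Gr\<^esub> arr_map d u = arr_map d' u \<cdot>\<^bsub>Gr\<^esub> \<alpha> (Dom (int_cat T) u)"
    using \<alpha> by (simp_all add: is_completion_def is_nat_trans_def)
  interpret d': gr_decomp T d' using d.T d' by (rule gr_decomp.intro)
  show ?thesis
  proof
    show "is_tree T" by (rule d.tree)
    fix u assume u: "u \<in> Arr (int_cat T)"
    note D = d.Dom_Cod_int[OF u]
    show "monic Gr (arr_map d' u)"
    proof (cases u)
      case (Idn i)
      then have i: "i \<in> int_objs T" using u by simp
      then show ?thesis
        using Idn d'.arr_Idn[OF i] monic_Gr[OF Ident_Gr[OF d'.obj[OF i]]] by (simp add: inj_on_def)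
    next
      case (Leg e x)
      then have e: "EdgeObj e \<in> int_objs T" "VertObj x \<in> int_objs T" using D by auto
      have l: "arr_map d u \<in> homset Gr (obj_map d (EdgeObj e)) (obj_map d (VertObj x))"
        using d.arr[OF u] Leg by simp
      have "\<alpha> (EdgeObj e) = Ident Gr (obj_map d (EdgeObj e))" "obj_map d' (EdgeObj e) = obj_map d (EdgeObj e)"
        using \<alpha> e by (auto simp: is_completion_def)
      moreover from this have l': "arr_map d' u \<in> homset Gr (obj_map d (EdgeObj e)) (obj_map d' (VertObj x))"
        using d'.arr[OF u] Leg by simp
      ultimately have eq: "\<alpha> (VertObj x) \<cdot>\<^bsub>Gr\<^esub> arr_map d u = arr_map d' u"
        using nat(2)[OF u] Leg Gr.Comp_Ident[OF l'] by simp
      have "inj_on (app (arr_map d u)) (pverts (obj_map d (EdgeObj e)))"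
        using d.monic_arr[OF u] monic_Gr[OF l] by simp
      moreover have "inj_on (app (\<alpha> (VertObj x))) (pverts (obj_map d (VertObj x)))"
        using \<alpha> e monic_Gr[OF nat(1)[OF e(2)]] by (simp add: is_completion_def)
      ultimately have "inj_on (app (arr_map d' u)) (pverts (obj_map d (EdgeObj e)))"
        unfolding eq[symmetric] inj_on_def using app_Comp[OF l] hom_vert[OF l] by simp
      then show ?thesis using monic_Gr[OF l'] by simp
    qed
  qed
qed

text \<open>Points of \<open>X\<close> with the same image under \<open>h\<close> come from bag
  points whose images under \<open>\<alpha>\<close> are joined by a zigzag of \<open>d'\<close>.
  Lifted to \<open>d\<close>, that zigzag already identifies the points in \<open>X\<close>.\<close>

lemma completion_colimit_monic:
  assumes d: "structured_decomp Gr Trees T d" and \<alpha>: "is_completion Gr \<Omega> T d d' \<alpha>"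
    and X: "is_colimit_cocone (int_cat T) Gr d X c" and X': "is_colimit_cocone (int_cat T) Gr d' X' c'"
    and h: "h \<in> homset Gr X X'" and hc: "\<forall>i \<in> Obj (int_cat T). h \<cdot>\<^bsub>Gr\<^esub> c i = c' i \<cdot>\<^bsub>Gr\<^esub> \<alpha> i"
  shows "monic Gr h"
proof -
  interpret d: gr_tree_decomp T d using structured_decomp_gr_tree_decomp[OF d] .
  interpret d': gr_tree_decomp T d' using completion_gr_tree_decomp[OF d \<alpha>] .
  have nat: "\<And>i. i \<in> int_objs T \<Longrightarrow> \<alpha> i \<in> homset Gr (obj_map d i) (obj_map d' i)"
    "\<And>u. u \<in> Arr (int_cat T) \<Longrightarrow> \<alpha> (Cod (int_cat T) u) \<cdot>\<^bsub>Gr\<^esub> arr_map d u = arr_map d' u \<cdot>\<^bsub>Gr\<^esub> \<alpha> (Dom (int_cat T) u)"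
    using \<alpha> by (simp_all add: is_completion_def is_nat_trans_def)
  have \<alpha>_edge: "\<alpha> (EdgeObj e) = Ident Gr (obj_map d (EdgeObj e))" "obj_map d' (EdgeObj e) = obj_map d (EdgeObj e)"
    if "EdgeObj e \<in> int_objs T" for e
    using \<alpha> that by (simp_all add: is_completion_def)
  have \<alpha>_inj: "inj_on (app (\<alpha> (VertObj v))) (pverts (obj_map d (VertObj v)))" if "v \<in> pverts T" for v
    using \<alpha> that monic_Gr[OF nat(1)[of "VertObj v"]] by (simp add: is_completion_def)
  have gX: "glued_cocone T d X c" by (rule d.colimit_glued[OF X])
  have gX': "glued_cocone T d' X' c'" by (rule d'.colimit_glued[OF X'])
  have leg': "app (arr_map d' (Leg e x)) y = app (\<alpha> (VertObj x)) (app (arr_map d (Leg e x)) y)"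
    if e: "EdgeObj e \<in> int_objs T" "x \<in> e" and y: "y \<in> pverts (obj_map d (EdgeObj e))" for e x y
  proof -
    have u: "Leg e x \<in> Arr (int_cat T)" using e by simp
    have l: "arr_map d (Leg e x) \<in> homset Gr (obj_map d (EdgeObj e)) (obj_map d (VertObj x))"
      using d.arr[OF u] by simp
    have "app (\<alpha> (VertObj x) \<cdot>\<^bsub>Gr\<^esub> arr_map d (Leg e x)) y = app (arr_map d' (Leg e x) \<cdot>\<^bsub>Gr\<^esub> \<alpha> (EdgeObj e)) y"
      using nat(2)[OF u] by simp
    then show ?thesis
      using app_Comp[OF l y] app_Comp[OF nat(1)[OF e(1)] y] \<alpha>_edge(1)[OF e(1)] y by simp
  qed
  text \<open>A completion does not change the adhesions, so every gluing step of the completed diagram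
    starts and ends inside the original bags.\<close>
  have lift: "\<exists>b. r = (fst r, app (\<alpha> (VertObj (fst r))) b) \<and> (fst r, b) \<in> bag_points T d \<and>
      ((v, a), (fst r, b)) \<in> (glue T d)\<^sup>*"
    if "((v, app (\<alpha> (VertObj v)) a), r) \<in> (glue T d')\<^sup>*" "(v, a) \<in> bag_points T d" for v a r
    using that(1)
  proof (induction rule: rtrancl_induct)
    case base
    show ?case using that(2) by auto
  next
    case (step r s)
    obtain w u y where wu: "(w, u) \<in> parcs T" and y': "y \<in> pverts (obj_map d' (EdgeObj {w, u}))"
      and r: "r = (w, app (arr_map d' (Leg {w, u} w)) y)" and s: "s = (u, app (arr_map d' (Leg {w, u} u)) y)"
      using step.hyps(2) by (rule d'.glueE)
    have e: "EdgeObj {w, u} \<in> int_objs T" using wu by auto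
    have y: "y \<in> pverts (obj_map d (EdgeObj {w, u}))" using y' \<alpha>_edge(2)[OF e] by simp
    obtain b where b: "r = (w, app (\<alpha> (VertObj w)) b)" "(w, b) \<in> bag_points T d"
        "((v, a), (w, b)) \<in> (glue T d)\<^sup>*"
      using step.IH r by auto
    have "app (\<alpha> (VertObj w)) (app (arr_map d (Leg {w, u} w)) y) = app (\<alpha> (VertObj w)) b"
      using leg'[OF e _ y, of w] r b(1) by simp
    then have "app (arr_map d (Leg {w, u} w)) y = b"
      using inj_onD[OF \<alpha>_inj[OF d.end_vert(1)[OF wu]]] hom_vert[OF d.leg(1)[OF wu] y] b(2)
      by (simp add: bag_points_def)
    then have "((v, a), (u, app (arr_map d (Leg {w, u} u)) y)) \<in> (glue T d)\<^sup>*"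
      using b(3) d.glueI[OF wu y] by (auto intro: rtrancl_into_rtrancl)
    then show ?case
      using leg'[OF e _ y, of u] s d.glue_bag_points(2)[OF d.glueI[OF wu y]] by auto
  qed
  have "inj_on (app h) (pverts X)"
  proof (rule inj_onI)
    fix x y assume x: "x \<in> pverts X" and y: "y \<in> pverts X" and eq: "app h x = app h y"
    obtain v a where va: "(v, a) \<in> bag_points T d" "app (c (VertObj v)) a = x"
      using glued_coconeD(2)[OF gX x] by blast
    obtain w b where wb: "(w, b) \<in> bag_points T d" "app (c (VertObj w)) b = y"
      using glued_coconeD(2)[OF gX y] by blast
    have *: "app h (app (c (VertObj v)) a) = app (c' (VertObj v)) (app (\<alpha> (VertObj v)) a) \<and>
        (v, app (\<alpha> (VertObj v)) a) \<in> bag_points T d'" if "(v, a) \<in> bag_points T d" for v a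
    proof -
      have v: "VertObj v \<in> int_objs T" and a: "a \<in> pverts (obj_map d (VertObj v))"
        using that by (auto simp: bag_points_def)
      show ?thesis
        using app_Comp[OF d.cocone_hom[OF glued_coconeD(1)[OF gX] v] a, of h]
          app_Comp[OF nat(1)[OF v] a, of "c' (VertObj v)"] hom_vert[OF nat(1)[OF v] a] hc v
        by (simp add: bag_points_def)
    qed
    have "((v, app (\<alpha> (VertObj v)) a), (w, app (\<alpha> (VertObj w)) b)) \<in> (glue T d')\<^sup>*"
      using *[OF va(1)] *[OF wb(1)] va(2) wb(2) eq by (intro glued_coconeD(4)[OF gX']) auto
    from lift[OF this va(1)] obtain b' where b': "app (\<alpha> (VertObj w)) b = app (\<alpha> (VertObj w)) b'"
        "(w, b') \<in> bag_points T d" "((v, a), (w, b')) \<in> (glue T d)\<^sup>*"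
      by auto
    \<comment> \<open>The lift ends at some point with the image of \<open>b\<close> under
      \<open>\<alpha>\<close>; injectivity of that component makes it \<open>b\<close>.\<close>
    then have "b' = b"
      using wb(1) inj_onD[OF \<alpha>_inj, of w b' b] by (simp add: bag_points_def)
    then show "x = y"
      using d.cocone_glue[OF glued_coconeD(1)[OF gX] b'(3)] va(2) wb(2) by simp
  qed
  then show ?thesis by (simp add: monic_Gr[OF h])
qed

section \<open>Verification of the axioms\<close>

lemma single_vertex_tree: "complete_gr 1 \<in> Trees"
proof -
  have K: "parcs (complete_gr 1) = {}" "pverts (complete_gr 1) = {0}"
    by (auto simp: complete_gr_def)
  have "\<not> pre_digraph.cycle (with_proj (complete_gr 1)) p" for p
    unfolding pre_digraph.cycle_def pre_digraph.awalk_def with_proj_simps K by auto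
  moreover have "Digraph_Component.connected (with_proj (complete_gr 1))"
    unfolding connected_conv with_proj_simps K by (simp add: rtrancl_on_refl)
  ultimately show ?thesis
    using complete_gr_Obj[of 1] unfolding Trees_def is_tree_def Obj_Gr by blast
qed

lemma complete_width_category_Gr: "complete_width_category Gr Trees clique_spine"
proof
  show "Trees \<subseteq> Obj Gr" by (auto simp: Trees_def)
  show "complete_gr 1 \<in> Trees" by (rule single_vertex_tree)
  show "\<exists>X c. is_colimit_cocone (int_cat T) Gr d X c" if "structured_decomp Gr Trees T d" for T d
  proof -
    interpret gr_tree_decomp T d using structured_decomp_gr_tree_decomp[OF that] .
    show ?thesis using glued_cocone_exists glued_cocone_imp_colimit by metis
  qed
  show "clique_spine n \<subseteq> Obj Gr" for n by (auto simp: clique_spine_def)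
  show "Y \<in> clique_spine n" if "X \<in> clique_spine n" "iso_objs Gr X Y" for X Y n
    using that iso_objs_card[OF that(2)] Gr.iso_objs_trans[OF Gr.iso_objs_sym[OF that(2)]]
    by (simp add: clique_spine_iff)
  show "clique_spine n \<subseteq> clique_spine (Suc n)" for n by (auto simp: clique_spine_iff)
  show "\<exists>W \<in> (\<Union>n. clique_spine n). \<exists>f \<in> homset Gr X W. monic Gr f" if "X \<in> Obj Gr" for X
    using monic_into_clique[OF that] complete_gr_in_spine by blast
  \<comment> \<open>By \<open>clique_spine_iff\<close>, \<open>W\<close> has exactly
    \<open>n\<close> vertices and \<open>Y\<close> at most \<open>n - 1\<close>.\<close>
  show "\<not> monic Gr f"
    if "n \<ge> 1" "W \<in> clique_spine n - clique_spine (n - 1)" "Y \<in> clique_spine (n - 1)" "f \<in> homset Gr W Y"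
    for n W Y f
    using that monic_card_le[OF that(4)] by (auto simp: clique_spine_iff)
  show "\<exists>p q. is_pullback Gr f g p q" if "monic Gr f" "g \<in> Arr Gr" "Cod Gr f = Cod Gr g" for f g
  proof (rule Gr_pullback_exists)
    show "f \<in> homset Gr (Dom Gr f) (Cod Gr f)" "g \<in> homset Gr (Dom Gr g) (Cod Gr f)"
      using that(2,3) that(1)[unfolded monic_def, THEN conjunct1] by (simp_all add: homset_def)
  qed
  show "\<exists>d' p q. is_pullback_cocone (int_cat T) Gr d c f d' p q"
    if d: "structured_decomp Gr Trees T d" and c: "is_colimit_cocone (int_cat T) Gr d Y c"
      and f: "f \<in> homset Gr X Y" for T d Y c f X
  proof -
    interpret gr_tree_decomp T d using structured_decomp_gr_tree_decomp[OF d] .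
    have "is_cocone (int_cat T) Gr d Y c" using c by (simp add: is_colimit_cocone_def)
    then show ?thesis
      using Gr_pullback_exists[OF f cocone_hom]
      by (intro Gr.pullback_cocone_exists[OF small_category_int_cat[OF T] gr_decomp.d[OF gr_decomp_axioms] _ f])
        simp_all
  qed
  show "is_colimit_cocone (int_cat T) Gr d' X p"
    if d: "structured_decomp Gr Trees T d" and c: "is_colimit_cocone (int_cat T) Gr d Y c"
      and f: "f \<in> homset Gr X Y" and pb: "is_pullback_cocone (int_cat T) Gr d c f d' p q"
    for T d Y c f X d' p q
  proof -
    interpret gr_tree_decomp T d using structured_decomp_gr_tree_decomp[OF d] .
    have "gr_decomp T d'" using T pb unfolding is_pullback_cocone_def by (blast intro: gr_decomp.intro)
    from gr_decomp.glued_cocone_imp_colimit[OF this pullback_glued_cocone[OF colimit_glued[OF c] f pb]]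
    show ?thesis .
  qed
qed (fact completion_colimit_monic)

section \<open>Width and treewidth\<close>

lemma apath_vertsD:
  assumes T: "is_tree T" and "pre_digraph.apath (with_proj T) r p s"
  shows "r \<in> pverts T" "s \<in> pverts T" "pcas r p s" "set p \<subseteq> parcs T"
proof -
  interpret T: pair_graph T using T by (simp add: is_tree_def)
  have "T.awalk r p s" using assms(2) by (rule T.awalkI_apath)
  then show "r \<in> pverts T" "s \<in> pverts T" "pcas r p s" "set p \<subseteq> parcs T"
    using T.awalk_last_in_verts by (auto simp: T.awalk_def)
qed

lemma (in gr_tree_decomp) rs_tree_decomp_of_bags:
  assumes X: "glued_cocone T d X c"
  shows "rs_tree_decomp X T (\<lambda>t. app (c (VertObj t)) ` pverts (obj_map d (VertObj t)))"
    (is "rs_tree_decomp X T ?B")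
  unfolding rs_tree_decomp_def
proof (intro conjI)
  note c = glued_coconeD(1)[OF X]
  show "is_tree T" by (rule tree)
  show sub: "\<forall>t \<in> pverts T. ?B t \<subseteq> pverts X"
    using hom_vert[OF cocone_hom[OF c]] by auto
  show "(\<Union>t \<in> pverts T. ?B t) = pverts X"
  proof
    show "pverts X \<subseteq> (\<Union>t \<in> pverts T. ?B t)"
    proof
      fix x assume "x \<in> pverts X"
      then obtain v a where "(v, a) \<in> bag_points T d" "app (c (VertObj v)) a = x"
        using glued_coconeD(2)[OF X] by blast
      then show "x \<in> (\<Union>t \<in> pverts T. ?B t)" by (auto simp: bag_points_def)
    qed
  qed (use sub in blast)
  show "\<forall>(x, y) \<in> parcs X. \<exists>t \<in> pverts T. x \<in> ?B t \<and> y \<in> ?B t"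
  proof clarify
    fix x y assume "(x, y) \<in> parcs X"
    then obtain v a b where v: "v \<in> pverts T" "(a, b) \<in> parcs (obj_map d (VertObj v))"
        "app (c (VertObj v)) a = x" "app (c (VertObj v)) b = y"
      using glued_coconeD(3)[OF X] by blast
    then show "\<exists>t \<in> pverts T. x \<in> ?B t \<and> y \<in> ?B t"
      using Obj_GrD(1,2)[OF obj v(2)] by (intro bexI[OF _ v(1)]) auto
  qed
  show "\<forall>t1 t2 t3 p. pre_digraph.apath (with_proj T) t1 p t3 \<and>
      t2 \<in> set (pre_digraph.awalk_verts (with_proj T) t1 p) \<longrightarrow> ?B t1 \<inter> ?B t3 \<subseteq> ?B t2"
  proof (intro allI impI subsetI, elim conjE IntE)
    fix t1 t2 t3 p x
    assume p: "pre_digraph.apath (with_proj T) t1 p t3"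
      and t2: "t2 \<in> set (pre_digraph.awalk_verts (with_proj T) t1 p)"
      and x1: "x \<in> ?B t1" and x3: "x \<in> ?B t3"
    show "x \<in> ?B t2"
    \<comment> \<open>\<open>tree_path_separates\<close> speaks of inner vertices of the path; at
      its ends the claim is trivial.\<close>
    proof (cases "t1 = t2 \<or> t3 = t2")
      case True
      then show ?thesis using x1 x3 by blast
    next
      case False
      obtain a where a: "(t1, a) \<in> bag_points T d" "x = app (c (VertObj t1)) a"
        using x1 apath_vertsD(1)[OF tree p] by (auto simp: bag_points_def)
      obtain b where b: "(t3, b) \<in> bag_points T d" "x = app (c (VertObj t3)) b"
        using x3 apath_vertsD(2)[OF tree p] by (auto simp: bag_points_def)
      have "((t1, a), (t3, b)) \<in> (glue T d)\<^sup>*"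
        using glued_coconeD(4)[OF X a(1) b(1)] a(2) b(2) by simp
      then obtain n where n: "((t1, a), (t3, b)) \<in> glue T d ^^ n" by (auto simp: rtrancl_power)
      have "(t1, t3) \<notin> (avoiding T t2)\<^sup>*"
        using tree_path_separates[OF tree p t2] False by auto
      \<comment> \<open>The zigzag joining the two preimages of \<open>x\<close> cannot bypass
        \<open>t2\<close>, so it has a point \<open>r\<close> over \<open>t2\<close>; as the cocone
        is constant along it, \<open>r\<close> is again a preimage of \<open>x\<close>.\<close>
      then obtain r i where r: "((t1, a), r) \<in> glue T d ^^ i" "fst r = t2"
        using relpow_visits_or_avoids[OF n glue_arc, where t = t2] by auto
      then have "((t1, a), r) \<in> (glue T d)\<^sup>*" by (auto simp: rtrancl_power)
      then have "r \<in> bag_points T d" "app (c (VertObj (fst r))) (snd r) = x"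
        using glue_rtrancl_bag_points a(1) cocone_glue[OF c, of "(t1, a)" r] a(2) by auto
      then show ?thesis using r(2) by (auto simp: bag_points_def)
    qed
  qed
qed

text \<open>The colimit is only isomorphic to \<open>G\<close>, so its legs are composed with the
  isomorphism to make the bags subsets of \<open>pverts G\<close>. These composites are injective,
  so the size of an image is the spine size of the bag.\<close>

lemma structured_decomp_imp_rs_tree_decomp:
  assumes "structured_decomp_of Gr Trees T d G"
  shows "\<exists>B. T \<in> Trees \<and> rs_tree_decomp G T B \<and> rs_width T B = decomp_width Gr clique_spine T d"
proof -
  obtain Z c where sd: "structured_decomp Gr Trees T d" and Z: "is_colimit_cocone (int_cat T) Gr d Z c"
    and "iso_objs Gr G Z"
    using assms unfolding structured_decomp_of_def by blast
  then obtain f g where fg: "f \<in> homset Gr G Z" "g \<in> homset Gr Z G"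
      "g \<cdot>\<^bsub>Gr\<^esub> f = Ident Gr G" "f \<cdot>\<^bsub>Gr\<^esub> g = Ident Gr Z"
    unfolding iso_objs_def by blast
  interpret gr_tree_decomp T d using structured_decomp_gr_tree_decomp[OF sd] .
  define b where "b i = g \<cdot>\<^bsub>Gr\<^esub> c i" for i
  have Zc: "glued_cocone T d Z c" by (rule colimit_glued[OF Z])
  have "is_cocone (int_cat T) Gr d G b"
    unfolding b_def
    using Gr.cocone_post_compose[OF d glued_coconeD(1)[OF Zc] fg(2)] Dom_Cod_int
    by simp
  then have G: "glued_cocone T d G b"
    by (intro glued_cocone_transfer[OF Zc fg(2,1,4,3)]) (simp_all add: b_def)
  define B where "B t = app (b (VertObj t)) ` pverts (obj_map d (VertObj t))" for t
  have "card (B t) = spine_size Gr clique_spine (obj_map d (VertObj t))" if "t \<in> pverts T" for t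
    using card_image[OF glued_cocone_inj[OF G that]] spine_size_Gr[OF obj, of "VertObj t"] that
    by (simp add: B_def)
  then have "rs_width T B = decomp_width Gr clique_spine T d"
    unfolding rs_width_def decomp_width_def by (simp cong: image_cong_simp)
  moreover have "rs_tree_decomp G T B"
    using rs_tree_decomp_of_bags[OF G] by (simp add: B_def[abs_def])
  moreover have "T \<in> Trees" using sd by (simp add: structured_decomp_def)
  ultimately show ?thesis by blast
qed

section \<open>From RS-tree decompositions to structured decompositions\<close>

lemma induced_subgraph_family:
  assumes G: "G \<in> Obj Gr"
  obtains R h where "\<And>S. S \<subseteq> pverts G \<Longrightarrow> R S \<in> Obj Gr"
    "\<And>S. S \<subseteq> pverts G \<Longrightarrow> bij_betw (h S) (pverts (R S)) S"
    "\<And>S i j. S \<subseteq> pverts G \<Longrightarrow> i \<in> pverts (R S) \<Longrightarrow> j \<in> pverts (R S) \<Longrightarrow>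
      (i, j) \<in> parcs (R S) \<longleftrightarrow> (h S i, h S j) \<in> parcs G"
proof -
  have "\<exists>R h. R \<in> Obj Gr \<and> bij_betw h (pverts R) S \<and>
      (\<forall>i \<in> pverts R. \<forall>j \<in> pverts R. (i, j) \<in> parcs R \<longleftrightarrow> (h i, h j) \<in> parcs G)"
    if S: "S \<subseteq> pverts G" for S
  proof -
    define H where "H = \<lparr>pverts = S, parcs = parcs G \<inter> S \<times> S\<rparr>"
    have "finite (pverts H)" using finite_subset[OF S Obj_Gr_finite[OF G]] by (simp add: H_def)
    moreover have "x \<in> pverts H \<and> x \<noteq> y \<and> (y, x) \<in> parcs H" if "(x, y) \<in> parcs H" for x y
      using that Obj_GrD[OF G, of x y] by (simp add: H_def)
    ultimately obtain R h where R: "R \<in> Obj Gr" "bij_betw h (pverts R) (pverts H)"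
      "\<And>i j. i \<in> pverts R \<Longrightarrow> j \<in> pverts R \<Longrightarrow> (i, j) \<in> parcs R \<longleftrightarrow> (h i, h j) \<in> parcs H"
      using relabel by blast
    have "h i \<in> S" if "i \<in> pverts R" for i using bij_betw_apply[OF R(2) that] by (simp add: H_def)
    then show ?thesis
      using R by (intro exI[of _ R] exI[of _ h]) (simp add: H_def)
  qed
  \<comment> \<open>One copy is fixed for each subset \<open>S\<close>. Equal bags thus share the
    same object, and the inclusion of \<open>S\<close> into itself is literally an identity
    arrow.\<close>
  then obtain R h where "\<And>S. S \<subseteq> pverts G \<Longrightarrow> R S \<in> Obj Gr \<and> bij_betw (h S) (pverts (R S)) S \<and>
      (\<forall>i \<in> pverts (R S). \<forall>j \<in> pverts (R S). (i, j) \<in> parcs (R S) \<longleftrightarrow> (h S i, h S j) \<in> parcs G)"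
    by metis
  then show ?thesis by (intro that[of R h]) blast+
qed

lemma rs_tree_decomp_imp_structured_decomp:
  assumes G: "G \<in> Obj Gr" and T_Trees: "T \<in> Trees" and rs: "rs_tree_decomp G T B"
  shows "\<exists>d. structured_decomp_of Gr Trees T d G \<and> rs_width T B = decomp_width Gr clique_spine T d"
proof -
  have tree: "is_tree T" and T_graph: "pair_graph T" using T_Trees by (simp_all add: Trees_def is_tree_def)
  interpret T: small_category "int_cat T" by (rule small_category_int_cat[OF T_graph])
  have B_sub: "B t \<subseteq> pverts G" if "t \<in> pverts T" for t
    using rs that by (simp add: rs_tree_decomp_def)
  have B_cover: "\<exists>t \<in> pverts T. x \<in> B t" if "x \<in> pverts G" for x
    using rs that unfolding rs_tree_decomp_def by blast
  have B_arc: "\<exists>t \<in> pverts T. x \<in> B t \<and> y \<in> B t" if "(x, y) \<in> parcs G" for x y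
    using rs that unfolding rs_tree_decomp_def by blast
  have B_path: "B t1 \<inter> B t3 \<subseteq> B t2" if "pre_digraph.apath (with_proj T) t1 p t3"
    "t2 \<in> set (pre_digraph.awalk_verts (with_proj T) t1 p)" for t1 t2 t3 p
    using rs that unfolding rs_tree_decomp_def by blast
  obtain R h where R: "\<And>S. S \<subseteq> pverts G \<Longrightarrow> R S \<in> Obj Gr"
    and h: "\<And>S. S \<subseteq> pverts G \<Longrightarrow> bij_betw (h S) (pverts (R S)) S"
    and arcR: "\<And>S i j. S \<subseteq> pverts G \<Longrightarrow> i \<in> pverts (R S) \<Longrightarrow> j \<in> pverts (R S) \<Longrightarrow>
      (i, j) \<in> parcs (R S) \<longleftrightarrow> (h S i, h S j) \<in> parcs G"
    using induced_subgraph_family[OF G] by metis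
  define k where "k S x = inv_into (pverts (R S)) (h S) x" for S x
  have k: "k S x \<in> pverts (R S)" "h S (k S x) = x" if "S \<subseteq> pverts G" "x \<in> S" for S x
    using bij_betw_inv_into_right[OF h[OF that(1)] that(2)]
      bij_betw_apply[OF bij_betw_inv_into[OF h[OF that(1)]] that(2)] by (simp_all add: k_def)
  have hR: "h S i \<in> S" "k S (h S i) = i" if "S \<subseteq> pverts G" "i \<in> pverts (R S)" for S i
    using bij_betw_inv_into_left[OF h[OF that(1)] that(2)] bij_betw_apply[OF h[OF that(1)] that(2)]
    by (simp_all add: k_def)
  \<comment> \<open>The inclusion of \<open>S\<close> into \<open>S'\<close>, read through the
    labellings: \<open>h S'\<close> after \<open>incl S S'\<close> is \<open>h S\<close>. The
    functor laws and injectivity follow from this equation.\<close>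
  define incl where "incl S S' = gr_arrow_of (R S) (\<lambda>i. k S' (h S i)) (R S')" for S S'
  have incl: "incl S S' \<in> homset Gr (R S) (R S')" if S: "S \<subseteq> S'" "S' \<subseteq> pverts G" for S S'
    unfolding incl_def
  proof (rule gr_arrow_ofI[OF R R])
    show S_G: "S \<subseteq> pverts G" "S' \<subseteq> pverts G" using S by auto
    have hS: "h S i \<in> S'" if "i \<in> pverts (R S)" for i using hR(1)[OF S_G(1) that] S by blast
    show "k S' (h S i) \<in> pverts (R S')" if "i \<in> pverts (R S)" for i
      using k(1)[OF S(2) hS[OF that]] .
    fix i j assume ij: "(i, j) \<in> parcs (R S)"
    note i = Obj_GrD(1,2)[OF R[OF S_G(1)] ij]
    have "(h S i, h S j) \<in> parcs G" using arcR[OF S_G(1) i] ij by simp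
    then show "(k S' (h S i), k S' (h S j)) \<in> parcs (R S')"
      using arcR[OF S(2) k(1)[OF S(2) hS[OF i(1)]] k(1)[OF S(2) hS[OF i(2)]]]
        k(2)[OF S(2) hS[OF i(1)]] k(2)[OF S(2) hS[OF i(2)]] by simp
  qed
  have app_incl: "app (incl S S') i = k S' (h S i)" "h S' (app (incl S S') i) = h S i"
    if "S \<subseteq> S'" "S' \<subseteq> pverts G" "i \<in> pverts (R S)" for S S' i
  proof -
    show "app (incl S S') i = k S' (h S i)" using that by (simp add: incl_def)
    moreover have "h S i \<in> S'" using hR(1)[of S i] that by blast
    ultimately show "h S' (app (incl S S') i) = h S i" using k(2)[OF that(2)] by simp
  qed
  have incl_monic: "monic Gr (incl S S')" if S: "S \<subseteq> S'" "S' \<subseteq> pverts G" for S S'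
    unfolding monic_Gr[OF incl[OF S]]
  proof (rule inj_onI)
    fix i j assume i: "i \<in> pverts (R S)" and j: "j \<in> pverts (R S)"
      and "app (incl S S') i = app (incl S S') j"
    then have "h S i = h S j" using app_incl(2)[OF S i] app_incl(2)[OF S j] by simp
    moreover have "S \<subseteq> pverts G" using S by auto
    ultimately show "i = j" using hR(2) i j by metis
  qed
  have incl_id: "incl S S = Ident Gr (R S)" if S: "S \<subseteq> pverts G" for S
    using hom_eqI[OF incl[OF subset_refl S] Ident_Gr[OF R[OF S]]]
      app_incl(1)[OF subset_refl S] hR(2)[OF S] by simp
  have incl_comp: "incl S' S'' \<cdot>\<^bsub>Gr\<^esub> incl S S' = incl S S''"
    if S: "S \<subseteq> S'" "S' \<subseteq> S''" "S'' \<subseteq> pverts G" for S S' S''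
  proof -
    have S': "S' \<subseteq> pverts G" "S \<subseteq> S''" using S by auto
    show ?thesis
    proof (rule hom_eqI[OF Comp_Gr[OF incl[OF S(1) S'(1)] incl[OF S(2,3)]] incl[OF S'(2) S(3)]])
      fix i assume i: "i \<in> pverts (R S)"
      show "app (incl S' S'' \<cdot>\<^bsub>Gr\<^esub> incl S S') i = app (incl S S'') i"
        unfolding app_Comp[OF incl[OF S(1) S'(1)] i]
          app_incl(1)[OF S(2,3) hom_vert[OF incl[OF S(1) S'(1)] i]]
          app_incl(2)[OF S(1) S'(1) i] app_incl(1)[OF S'(2) S(3) i] ..
    qed
  qed
  \<comment> \<open>The adhesion of two adjacent bags, written as an intersection over the unordered
    edge so that no end has to come first.\<close>
  define bag where "bag i = (case i of VertObj v \<Rightarrow> B v | EdgeObj e \<Rightarrow> (\<Inter>x \<in> e. B x))" for i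
  have bag_simps: "bag (VertObj v) = B v" "bag (EdgeObj e) = (\<Inter>x \<in> e. B x)" for v e
    by (simp_all add: bag_def)
  define d where "d = \<lparr>obj_map = (\<lambda>i. R (bag i)),
    arr_map = (\<lambda>u. incl (bag (Dom (int_cat T) u)) (bag (Cod (int_cat T) u)))\<rparr>"
  have d_simps: "obj_map d i = R (bag i)"
    "arr_map d u = incl (bag (Dom (int_cat T) u)) (bag (Cod (int_cat T) u))" for i u
    by (simp_all add: d_def)
  have arc_vert: "x \<in> pverts T" "y \<in> pverts T" if "(x, y) \<in> parcs T" for x y
    using Obj_GrD(1,2)[OF _ that] T_Trees by (simp_all add: Trees_def)
  have bag_G: "bag i \<subseteq> pverts G" if i: "i \<in> int_objs T" for i
  proof (cases i)
    case (VertObj v)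
    then show ?thesis using B_sub i by (simp add: bag_simps)
  next
    case (EdgeObj e)
    with i obtain x y where xy: "e = {x, y}" "(x, y) \<in> parcs T" by auto
    show ?thesis using B_sub[OF arc_vert(1)[OF xy(2)]] EdgeObj xy(1) by (auto simp: bag_simps)
  qed
  have bag_mono: "bag (Dom (int_cat T) u) \<subseteq> bag (Cod (int_cat T) u)" if "u \<in> Arr (int_cat T)" for u
    using that by (cases u) (auto simp: bag_simps)
  have u_incl: "bag (Dom (int_cat T) u) \<subseteq> bag (Cod (int_cat T) u)" "bag (Cod (int_cat T) u) \<subseteq> pverts G"
    if "u \<in> Arr (int_cat T)" for u
    using bag_mono[OF that] bag_G T.Cod_in_Obj[OF that] by auto
  have d_functor: "is_functor (int_cat T) Gr d"
    unfolding is_functor_def d_simps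
  proof (intro conjI ballI impI)
    show "R (bag i) \<in> Obj Gr" if "i \<in> Obj (int_cat T)" for i using R bag_G that by simp
    show "incl (bag (Dom (int_cat T) u)) (bag (Cod (int_cat T) u))
        \<in> homset Gr (R (bag (Dom (int_cat T) u))) (R (bag (Cod (int_cat T) u)))"
      if "u \<in> Arr (int_cat T)" for u
      by (rule incl[OF u_incl[OF that]])
    show "incl (bag (Dom (int_cat T) (Ident (int_cat T) i))) (bag (Cod (int_cat T) (Ident (int_cat T) i)))
        = Ident Gr (R (bag i))" if "i \<in> Obj (int_cat T)" for i
      using incl_id bag_G that by simp
    fix u v assume uv: "u \<in> Arr (int_cat T)" "v \<in> Arr (int_cat T)" "Cod (int_cat T) u = Dom (int_cat T) v"
    then have "v \<cdot>\<^bsub>int_cat T\<^esub> u \<in> homset (int_cat T) (Dom (int_cat T) u) (Cod (int_cat T) v)"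
      by (intro T.Comp_in_homset[of u _ "Cod (int_cat T) u"]) (simp_all add: homset_def)
    then show "incl (bag (Dom (int_cat T) (v \<cdot>\<^bsub>int_cat T\<^esub> u))) (bag (Cod (int_cat T) (v \<cdot>\<^bsub>int_cat T\<^esub> u)))
        = incl (bag (Dom (int_cat T) v)) (bag (Cod (int_cat T) v)) \<cdot>\<^bsub>Gr\<^esub>
          incl (bag (Dom (int_cat T) u)) (bag (Cod (int_cat T) u))"
      using incl_comp[OF u_incl(1)[OF uv(1)] _ u_incl(2)[OF uv(2)]] u_incl(1)[OF uv(2)] uv(3)
      by (simp add: homset_def)
  qed
  interpret gr_decomp T d using T_graph d_functor by (rule gr_decomp.intro)
  have d_decomp: "structured_decomp Gr Trees T d"
    unfolding structured_decomp_def d_simps using T_Trees d_functor incl_monic[OF u_incl] by blast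
  define c where "c i = gr_arrow_of (R (bag i)) (h (bag i)) G" for i
  have c_hom: "c i \<in> homset Gr (R (bag i)) G" if i: "i \<in> int_objs T" for i
    unfolding c_def
  proof (rule gr_arrow_ofI[OF R[OF bag_G[OF i]] G])
    show "h (bag i) a \<in> pverts G" if "a \<in> pverts (R (bag i))" for a
      using hR(1)[OF bag_G[OF i] that] bag_G[OF i] by blast
    show "(h (bag i) a, h (bag i) b) \<in> parcs G" if ab: "(a, b) \<in> parcs (R (bag i))" for a b
      using arcR[OF bag_G[OF i] Obj_GrD(1,2)[OF R[OF bag_G[OF i]] ab]] ab by simp
  qed
  have app_c: "app (c i) a = h (bag i) a" if "a \<in> pverts (R (bag i))" for i a
    using that by (simp add: c_def)
  have cocone: "is_cocone (int_cat T) Gr d G c"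
    unfolding is_cocone_def d_simps
  proof (intro conjI ballI)
    show "G \<in> Obj Gr" by (rule G)
    show "c i \<in> homset Gr (R (bag i)) G" if "i \<in> Obj (int_cat T)" for i using c_hom that by simp
    fix u assume u: "u \<in> Arr (int_cat T)"
    let ?S = "bag (Dom (int_cat T) u)" and ?S' = "bag (Cod (int_cat T) u)"
    note D = Dom_Cod_int[OF u]
    note l = incl[OF u_incl[OF u]]
    show "c (Cod (int_cat T) u) \<cdot>\<^bsub>Gr\<^esub> incl ?S ?S' = c (Dom (int_cat T) u)"
    proof (rule hom_eqI[OF Comp_Gr[OF l c_hom[OF conjunct2[OF D]]] c_hom[OF conjunct1[OF D]]])
      fix a assume a: "a \<in> pverts (R ?S)"
      show "app (c (Cod (int_cat T) u) \<cdot>\<^bsub>Gr\<^esub> incl ?S ?S') a = app (c (Dom (int_cat T) u)) a"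
        unfolding app_Comp[OF l a] app_c[OF hom_vert[OF l a]] app_c[OF a] by (rule app_incl(2)[OF u_incl[OF u] a])
    qed
  qed
  have point: "(v, k (B v) x) \<in> bag_points T d" "app (c (VertObj v)) (k (B v) x) = x"
    if v: "v \<in> pverts T" and x: "x \<in> B v" for v x
    using k[OF B_sub[OF v] x] app_c[of "k (B v) x" "VertObj v"] v by (simp_all add: bag_points_def d_simps bag_simps)
  \<comment> \<open>At each arc of the walk \<open>x\<close> lies in both end bags, hence in the
    adhesion, and the copy of \<open>x\<close> there is sent to its copies in both bags.\<close>
  have glue_walk: "((v, k (B v) x), (w, k (B w) x)) \<in> (glue T d)\<^sup>*"
    if "pcas v p w" "set p \<subseteq> parcs T" "\<And>t. t \<in> set (pawalk_verts v p) \<Longrightarrow> x \<in> B t" for v w p x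
    using that
  proof (induction p arbitrary: v)
    case (Cons e p)
    obtain u where e: "e = (v, u)" "(v, u) \<in> parcs T" using Cons.prems by (cases e) auto
    have "u \<in> set (pawalk_verts u p)" using Cons.prems(1) e(1) by (cases p) auto
    then have xv: "x \<in> B v" "x \<in> B u" using Cons.prems(3)[of v] Cons.prems(3)[of u] e(1) by simp_all
    define S where "S = bag (EdgeObj {v, u})"
    have S: "S = B v \<inter> B u" "S \<subseteq> pverts G" using B_sub arc_vert[OF e(2)] by (auto simp: S_def bag_simps)
    have z: "k S x \<in> pverts (R S)" "h S (k S x) = x" using k[OF S(2), of x] xv S(1) by auto
    have leg: "app (arr_map d (Leg {v, u} t)) (k S x) = k (B t) x" if t: "t \<in> {v, u}" for t
    proof -
      have "S \<subseteq> B t" "B t \<subseteq> pverts G" using S(1) t B_sub arc_vert[OF e(2)] by auto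
      from app_incl(1)[OF this z(1)] show ?thesis using z(2) by (simp add: d_simps bag_simps S_def)
    qed
    have "((v, k (B v) x), (u, k (B u) x)) \<in> glue T d"
      using glueI[OF e(2), of "k S x"] z(1) leg[of v] leg[of u] by (simp add: d_simps S_def)
    moreover have "((u, k (B u) x), (w, k (B w) x)) \<in> (glue T d)\<^sup>*"
      using Cons.prems e by (intro Cons.IH) auto
    ultimately show ?case by (rule converse_rtrancl_into_rtrancl)
  qed simp
  have "glued_cocone T d G c"
    unfolding glued_cocone_def
  proof (intro conjI)
    show "is_cocone (int_cat T) Gr d G c" by (rule cocone)
    show "\<forall>x \<in> pverts G. \<exists>(v, a) \<in> bag_points T d. app (c (VertObj v)) a = x"
      using B_cover point by blast
    show "\<forall>(x, y) \<in> parcs G. \<exists>v \<in> pverts T. \<exists>(a, b) \<in> parcs (obj_map d (VertObj v)).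
        app (c (VertObj v)) a = x \<and> app (c (VertObj v)) b = y"
    proof clarify
      fix x y assume xy: "(x, y) \<in> parcs G"
      then obtain v where v: "v \<in> pverts T" "x \<in> B v" "y \<in> B v" using B_arc by blast
      \<comment> \<open>The bag carries the induced subgraph, so an edge of \<open>G\<close> with
        both ends in \<open>B v\<close> is present in it.\<close>
      have "(k (B v) x, k (B v) y) \<in> parcs (obj_map d (VertObj v))"
        using arcR[OF B_sub[OF v(1)] k(1)[OF B_sub[OF v(1)] v(2)] k(1)[OF B_sub[OF v(1)] v(3)]]
          k(2)[OF B_sub[OF v(1)] v(2)] k(2)[OF B_sub[OF v(1)] v(3)] xy by (simp add: d_simps bag_simps)
      then show "\<exists>v \<in> pverts T. \<exists>(a, b) \<in> parcs (obj_map d (VertObj v)).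
          app (c (VertObj v)) a = x \<and> app (c (VertObj v)) b = y"
        using point(2)[OF v(1,2)] point(2)[OF v(1,3)] v(1) by blast
    qed
    show "\<forall>(v, a) \<in> bag_points T d. \<forall>(w, b) \<in> bag_points T d.
        app (c (VertObj v)) a = app (c (VertObj w)) b \<longrightarrow> ((v, a), (w, b)) \<in> (glue T d)\<^sup>*"
    proof clarify
      fix v a w b assume "(v, a) \<in> bag_points T d" "(w, b) \<in> bag_points T d"
        and eq: "app (c (VertObj v)) a = app (c (VertObj w)) b"
      then have v: "v \<in> pverts T" "a \<in> pverts (R (B v))" and w: "w \<in> pverts T" "b \<in> pverts (R (B w))"
        by (auto simp: bag_points_def d_simps bag_simps)
      define x where "x = h (B v) a"
      have x: "x = h (B w) b" "x \<in> B v" "x \<in> B w" "a = k (B v) x" "b = k (B w) x"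
        using eq app_c[of a "VertObj v"] app_c[of b "VertObj w"] v w hR[OF B_sub[OF v(1)] v(2)]
          hR[OF B_sub[OF w(1)] w(2)] by (simp_all add: x_def bag_simps)
      obtain p where p: "pre_digraph.apath (with_proj T) v p w"
        using tree_path[OF tree v(1) w(1)] by blast
      \<comment> \<open>The path condition of the RS-tree decomposition keeps \<open>x\<close> in
        every bag along the tree path from \<open>v\<close> to \<open>w\<close>, as
        \<open>glue_walk\<close> requires.\<close>
      have "x \<in> B t" if "t \<in> set (pawalk_verts v p)" for t
        using B_path[OF p, of t] that x(2,3) by (auto simp: awalk_verts_with_proj_eq)
      from glue_walk[OF apath_vertsD(3,4)[OF tree p] this]
      show "((v, a), (w, b)) \<in> (glue T d)\<^sup>*" using x(4,5) by simp
    qed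
  qed
  then have "structured_decomp_of Gr Trees T d G"
    unfolding structured_decomp_of_def
    using d_decomp glued_cocone_imp_colimit iso_objs_refl[OF G] by blast
  moreover have "rs_width T B = decomp_width Gr clique_spine T d"
  proof -
    have "spine_size Gr clique_spine (obj_map d (VertObj t)) = card (B t)" if "t \<in> pverts T" for t
      using spine_size_Gr[OF R[OF B_sub[OF that]]] bij_betw_same_card[OF h[OF B_sub[OF that]]]
      by (simp add: d_simps bag_simps)
    then show ?thesis
      unfolding rs_width_def decomp_width_def by (simp cong: image_cong_simp)
  qed
  ultimately show ?thesis by blast
qed

theorem proposition3p1p1:
  shows "complete_width_category Gr Trees clique_spine \<and>
    (\<forall>G \<in> Obj Gr. Gamma_width Gr Trees clique_spine G = treewidth G)"
proof (intro conjI ballI)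
  show "complete_width_category Gr Trees clique_spine" by (rule complete_width_category_Gr)
  fix G assume G: "G \<in> Obj Gr"
  \<comment> \<open>Both widths are \<open>LEAST\<close> of a predicate on integers. The two
    constructions preserve the shape and the width, so the predicates coincide and the minima
    agree.\<close>
  have "(\<exists>T d. structured_decomp_of Gr Trees T d G \<and> k = decomp_width Gr clique_spine T d) \<longleftrightarrow>
      (\<exists>T \<in> Trees. \<exists>B. rs_tree_decomp G T B \<and> k = rs_width T B)" for k
    using structured_decomp_imp_rs_tree_decomp[of _ _ G] rs_tree_decomp_imp_structured_decomp[OF G] by metis
  then show "Gamma_width Gr Trees clique_spine G = treewidth G"
    unfolding Gamma_width_def treewidth_def by simp
qed

end
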